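(* Let $(Y,\mathbb{C})$ be a periodic elastic structure in the $n$-dimensional Euclidean point space $\mathcal{E}$ with translation space $\mathcal{V}$, and let $\mathbb{C}^0$ be its macroscopic elasticity tensor. Let $h:\mathcal{E}\to\mathcal{E}$, $h(z)=z_\circ+\mathbf{a}+\mathbf{H}(z-z_\circ)$, where $z_\circ\in\mathcal{E}$, $\mathbf{a}\in\mathcal{V}$ and $\mathbf{H}:\mathcal{V}\to\mathcal{V}$ is linear with $|\det\mathbf{H}|=1$. If $h$ is a symmetry of $(Y,\mathbb{C})$, i.e. $$\mathbb{C}(z)\mathbf{E}=\mathbf{H}\big[\mathbb{C}(h^{-1}(z))(\mathbf{H}^\top\mathbf{E}\mathbf{H})\big]\mathbf{H}^\top\quad\text{for all } z\in\mathcal{E},\ \mathbf{E}\in\mathrm{Sym},$$ then $$\mathbb{C}^0\mathbf{E}=\mathbf{H}\big[\mathbb{C}^0(\mathbf{H}^\top\mathbf{E}\mathbf{H})\big]\mathbf{H}^\top\quad\text{for all } \mathbf{E}\in\mathrm{Sym}.$$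
   Context: Setting. $\mathcal{E}$ is an $n$-dimensional Euclidean point space ($n\in\mathbb{N}$, $n\ge 1$; one may take $\mathcal{E}=\mathbb{R}^n$) with translation space $\mathcal{V}$, an $n$-dimensional real inner product space. $\mathrm{Lin}$ is the space of linear maps $\mathcal{V}\to\mathcal{V}$ with inner product $\mathbf{A}\cdot\mathbf{B}=\mathrm{tr}(\mathbf{A}^\top\mathbf{B})$ and norm $|\mathbf{A}|$; $\mathrm{Sym}\subset\mathrm{Lin}$ is the subspace of symmetric maps. Unit cell. $Y=\{o+\sum_{i=1}^n t_i\mathbf{b}_i : 0\le t_i<1\}$ is a parallelepiped in $\mathcal{E}$ with corner $o\in\mathcal{E}$ and linearly independent edge vectors $\mathbf{b}_1,\dots,\mathbf{b}_n\in\mathcal{V}$. A function on $\mathcal{E}$ is $Y$-periodic if it is invariant under translation by each $\mathbf{b}_i$. Periodic elastic structure. A pair $(Y,\mathbb{C})$ where $\mathbb{C}$ assigns to each point an elasticity tensor (a linear map $\mathbb{C}(y):\mathrm{Lin}\to\mathrm{Lin}$), is defined on $Y$ and is extended $Y$-periodically to all of $\mathcal{E}$. Standing assumptions: $y\mapsto\mathbb{C}(y)$ is measurable; there is $M>0$ with $|\mathbb{C}(y)|\le M$ for almost every $y\in Y$; there is $\alpha>0$ with $\alpha|\mathbf{E}|^2\le\mathbf{E}\cdot\mathbb{C}(y)\mathbf{E}$ for all $\mathbf{E}\in\mathrm{Sym}$ (for almost every $y$); $\mathbf{A}\cdot\mathbb{C}(y)\mathbf{B}=\mathbf{A}\cdot\mathbb{C}(y)[\tfrac12(\mathbf{B}+\mathbf{B}^\top)]=[\tfrac12(\mathbf{A}+\mathbf{A}^\top)]\cdot\mathbb{C}(y)\mathbf{B}$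 for all $\mathbf{A},\mathbf{B}\in\mathrm{Lin}$ (minor symmetries); $\mathbf{D}\cdot\mathbb{C}(y)\mathbf{E}=\mathbf{E}\cdot\mathbb{C}(y)\mathbf{D}$ for all $\mathbf{D},\mathbf{E}\in\mathrm{Sym}$ (major symmetry). Function spaces. $H^1_{\mathrm{per}}(Y,\mathcal{V})$ is the completion, in the $H^1(Y,\mathcal{V})$-norm, of the space of smooth $Y$-periodic functions $\mathcal{E}\to\mathcal{V}$. $\mathcal{W}_{\mathrm{per}}(Y,\mathcal{V})$ is the quotient of $H^1_{\mathrm{per}}(Y,\mathcal{V})$ obtained by identifying functions that differ by a constant vector. Macroscopic elasticity tensor. For each $\mathbf{E}\in\mathrm{Sym}$ let $\mathbf{w}^{\mathbf{E}}\in\mathcal{W}_{\mathrm{per}}(Y,\mathcal{V})$ be the unique solution of the unit cell problem $$\int_Y\mathbb{C}(y)\big[\mathbf{E}+\nabla_y\mathbf{w}^{\mathbf{E}}(y)\big]\cdot\nabla_y\mathbf{v}(y)\,dy=0\quad\text{for all }\mathbf{v}\in H^1_{\mathrm{per}}(Y,\mathcal{V}).$$ Then $\mathbb{C}^0:\mathrm{Sym}\to\mathrm{Sym}$ is defined by $$\mathbb{C}^0\mathbf{E}=\frac{1}{|Y|}\int_Y\mathbb{C}(y)\big[\mathbf{E}+\nabla_y\mathbf{w}^{\mathbf{E}}(y)\big]\,dy,$$ where $|Y|$ is the volume of $Y$. *)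

theory Defs
  imports "HOL-Analysis.Analysis"
begin

text \<open>
  Points and translations are both vectors in \<open>real ^ 'n\<close>, and \<open>Lin\<close> is the matrix
  type \<open>real ^ 'n ^ 'n\<close>, whose library inner product is \<open>tr (A\<^sup>T B)\<close> (Frobenius).
  Elasticity tensors are bounded linear maps on \<open>Lin\<close>; their norm is the operator norm
  and their measurability refers to the corresponding Borel sets.
\<close>

type_synonym 'n lin = "real ^ 'n ^ 'n"

type_synonym 'n elasticity_tensor = "(real ^ 'n ^ 'n) \<Rightarrow>\<^sub>L (real ^ 'n ^ 'n)"

definition Sym :: "('n::finite) lin set" where
  "Sym = {A. transpose A = A}"

definition sym_part :: "('n::finite) lin \<Rightarrow> 'n lin" where
  "sym_part A = (1 / 2) *\<^sub>R (A + transpose A)"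

definition unit_cell :: "real ^ 'n \<Rightarrow> ('n::finite \<Rightarrow> real ^ 'n) \<Rightarrow> (real ^ 'n) set" where
  "unit_cell p b = {p + (\<Sum>i\<in>UNIV. t i *\<^sub>R b i) | t. \<forall>i. 0 \<le> t i \<and> t i < 1}"

definition periodic :: "('n::finite \<Rightarrow> real ^ 'n) \<Rightarrow> (real ^ 'n \<Rightarrow> 'c) \<Rightarrow> bool" where
  "periodic b f \<longleftrightarrow> (\<forall>x i. f (x + b i) = f x)"

definition periodic_elastic_structure ::
    "real ^ 'n \<Rightarrow> ('n::finite \<Rightarrow> real ^ 'n) \<Rightarrow> (real ^ 'n \<Rightarrow> 'n elasticity_tensor) \<Rightarrow> bool" where
  "periodic_elastic_structure p b C \<longleftrightarrow>
     inj b \<and> independent (range b) \<and>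
     periodic b C \<and>
     C \<in> borel_measurable lebesgue \<and>
     (\<exists>M>0. AE y in lebesgue_on (unit_cell p b). norm (C y) \<le> M) \<and>
     (\<exists>\<alpha>>0. AE y in lebesgue_on (unit_cell p b).
        \<forall>E\<in>Sym. \<alpha> * (norm E)\<^sup>2 \<le> E \<bullet> blinfun_apply (C y) E) \<and>
     (\<forall>y A B. A \<bullet> blinfun_apply (C y) B = A \<bullet> blinfun_apply (C y) (sym_part B) \<and>
              A \<bullet> blinfun_apply (C y) B = sym_part A \<bullet> blinfun_apply (C y) B) \<and>
     (\<forall>y. \<forall>D\<in>Sym. \<forall>E\<in>Sym. D \<bullet> blinfun_apply (C y) E = E \<bullet> blinfun_apply (C y) D)"

text \<open>Functions of class \<open>C\<^sup>k\<close> on the whole space, via iterated directional derivatives.\<close>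

primrec C_k :: "nat \<Rightarrow> ('a::real_normed_vector \<Rightarrow> 'b::real_normed_vector) \<Rightarrow> bool" where
  "C_k 0 f \<longleftrightarrow> continuous_on UNIV f"
| "C_k (Suc k) f \<longleftrightarrow>
     (\<forall>x. f differentiable (at x)) \<and> (\<forall>u. C_k k (\<lambda>x. frechet_derivative f (at x) u))"

definition smooth :: "('a::real_normed_vector \<Rightarrow> 'b::real_normed_vector) \<Rightarrow> bool" where
  "smooth f \<longleftrightarrow> (\<forall>k. C_k k f)"

definition square_integrable ::
    "'a::euclidean_space set \<Rightarrow> ('a \<Rightarrow> 'b::euclidean_space) \<Rightarrow> bool" where
  "square_integrable S f \<longleftrightarrow>
     f \<in> borel_measurable (lebesgue_on S) \<and> integrable (lebesgue_on S) (\<lambda>y. (norm (f y))\<^sup>2)"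

text \<open>
  The completion of the smooth periodic functions in the \<open>H\<^sup>1\<close>-norm, realised as the
  closure of the pairs \<open>(\<phi>, \<nabla>\<phi>)\<close> in \<open>L\<^sup>2 \<times> L\<^sup>2\<close>. An element is a pair \<open>(v, G)\<close> of
  representatives, with \<open>G\<close> playing the role of \<open>\<nabla>v\<close> (it is determined by \<open>v\<close> up to null
  sets, being its weak gradient).
\<close>

definition H1_per ::
    "real ^ 'n \<Rightarrow> ('n::finite \<Rightarrow> real ^ 'n) \<Rightarrow> ((real ^ 'n \<Rightarrow> real ^ 'n) \<times> (real ^ 'n \<Rightarrow> 'n lin)) set" where
  "H1_per p b = {(v, G).
     square_integrable (unit_cell p b) v \<and> square_integrable (unit_cell p b) G \<and>
     (\<exists>\<phi> :: nat \<Rightarrow> real ^ 'n \<Rightarrow> real ^ 'n.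
        (\<forall>k. smooth (\<phi> k) \<and> periodic b (\<phi> k)) \<and>
        (\<lambda>k. \<integral>y. (norm (\<phi> k y - v y))\<^sup>2 + (norm (jacobian (\<phi> k) (at y) - G y))\<^sup>2
               \<partial>lebesgue_on (unit_cell p b)) \<longlonglongrightarrow> 0)}"

definition constant_shift_rel ::
    "real ^ 'n \<Rightarrow> ('n::finite \<Rightarrow> real ^ 'n) \<Rightarrow>
     ((real ^ 'n \<Rightarrow> real ^ 'n) \<times> (real ^ 'n \<Rightarrow> 'n lin)) rel" where
  "constant_shift_rel p b = {((v, G), (v', G')).
     (v, G) \<in> H1_per p b \<and> (v', G') \<in> H1_per p b \<and>
     (\<exists>c. AE y in lebesgue_on (unit_cell p b). v' y = v y + c)}"

definition W_per ::
    "real ^ 'n \<Rightarrow> ('n::finite \<Rightarrow> real ^ 'n) \<Rightarrow>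
     ((real ^ 'n \<Rightarrow> real ^ 'n) \<times> (real ^ 'n \<Rightarrow> 'n lin)) set set" where
  "W_per p b = H1_per p b // constant_shift_rel p b"

definition unit_cell_solution ::
    "real ^ 'n \<Rightarrow> ('n::finite \<Rightarrow> real ^ 'n) \<Rightarrow> (real ^ 'n \<Rightarrow> 'n elasticity_tensor) \<Rightarrow> 'n lin \<Rightarrow>
     ((real ^ 'n \<Rightarrow> real ^ 'n) \<times> (real ^ 'n \<Rightarrow> 'n lin)) set \<Rightarrow> bool" where
  "unit_cell_solution p b C E W \<longleftrightarrow>
     W \<in> W_per p b \<and>
     (\<forall>(w, G)\<in>W. \<forall>(v, K)\<in>H1_per p b.
        (\<integral>y. blinfun_apply (C y) (E + G y) \<bullet> K y \<partial>lebesgue_on (unit_cell p b)) = 0)"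

text \<open>
  \<open>C0\<close> is the macroscopic elasticity tensor of \<open>(Y, C)\<close>. For a periodic elastic
  structure the cell problem is uniquely solvable, so this determines \<open>C0\<close> on \<open>Sym\<close>;
  values outside \<open>Sym\<close> are left free.
\<close>

definition macroscopic_elasticity_tensor ::
    "real ^ 'n \<Rightarrow> ('n::finite \<Rightarrow> real ^ 'n) \<Rightarrow> (real ^ 'n \<Rightarrow> 'n elasticity_tensor) \<Rightarrow>
     ('n lin \<Rightarrow> 'n lin) \<Rightarrow> bool" where
  "macroscopic_elasticity_tensor p b C C0 \<longleftrightarrow>
     (\<forall>E\<in>Sym. \<exists>W. unit_cell_solution p b C E W \<and>
        (\<forall>(w, G)\<in>W. C0 E = (1 / measure lebesgue (unit_cell p b)) *\<^sub>R
           (\<integral>y. blinfun_apply (C y) (E + G y) \<partial>lebesgue_on (unit_cell p b))))"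

definition symmetry_of ::
    "(real ^ 'n \<Rightarrow> ('n::finite) elasticity_tensor) \<Rightarrow> (real ^ 'n \<Rightarrow> real ^ 'n) \<Rightarrow> 'n lin \<Rightarrow> bool" where
  "symmetry_of C h H \<longleftrightarrow>
     (\<forall>z. \<forall>E\<in>Sym. blinfun_apply (C z) E =
        H ** blinfun_apply (C (inv h z)) (transpose H ** E ** H) ** transpose H)"

end

(*
The symmetry h need not map the period lattice to itself, so the cell problem cannot simply be
transported along h. Instead, compare energies: |Y| E.C0 E is the infimum of the integrals over Y of
C(E + grad phi).(E + grad phi) over smooth Y-periodic phi. Given phi, put psi = H^T phi(h(.)); the
symmetry of C turns the energy density of H^T E H + grad psi at y into that of E + grad phi at h(y).
The function psi is not Y-periodic, but cutting it off inside a block of N^n cells and averaging the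
result over the lattice gives a Y-periodic competitor for H^T E H whose mean energy, by convexity,
exceeds that of phi by at most O(1/N). Hence E.C0 E does not increase under E -> H^T E H; the inverse
of h gives the reverse inequality, and polarization recovers C0.
*)

theory Submission
  imports Defs
begin

section \<open>Smooth functions\<close>

text \<open>Cutting off and averaging destroy the cell equation, so nothing here tracks solutions;
  only admissible competitors and their energies are compared. Smooth competitors matter because a
  smooth periodic phi is bounded together with its gradient. Hence psi is too, and the cut-off
  disturbs a bounded energy density on a layer whose volume has order N^(n-1), provided the slope of
  the cut-off does not depend on N; its transitions therefore have width one for every N. The second
  error is geometric: h maps a block of N^n cells onto a set that is not a union of cells. With |det
  H| = 1, comparing volumes shows that it meets at most (N + 2k)^n cells, where k does not depend on
  N. After division by N^n both errors vanish in the limit. Integrals over blocks are taken as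
  non-negative integrals, for which tilings and changes of variables ask only for measurability.
  Gradients are not symmetric matrices, so the energy identities are needed on all matrices; the
  minor symmetries extend them from \<open>Sym\<close>.\<close>

lemma C_k_Suc_I:
  assumes "\<And>x. (f has_derivative f' x) (at x)" "\<And>u. C_k k (\<lambda>x. f' x u)"
  shows "C_k (Suc k) f"
proof -
  have "frechet_derivative f (at x) = f' x" for x
    using frechet_derivative_at[OF assms(1)] by metis
  then show ?thesis
    using assms by (auto simp: differentiable_def)
qed

lemma C_k_Suc_D:
  assumes "C_k (Suc k) f"
  shows "(f has_derivative frechet_derivative f (at x)) (at x)"
    "C_k k (\<lambda>x. frechet_derivative f (at x) u)"
  using assms by (auto simp: frechet_derivative_works)

lemma C_k_lower: "C_k (Suc k) f \<Longrightarrow> C_k k f"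
proof (induction k arbitrary: f)
  case 0
  then show ?case
    by (auto simp: continuous_on_eq_continuous_at intro: differentiable_imp_continuous_within)
next
  case (Suc k)
  then show ?case
    by (metis C_k.simps(2))
qed

text \<open>The pattern of the closure lemmas: \<open>C_k_Suc_I\<close> accepts an explicit
  derivative, and the induction generalizes over f because that derivative is built from directional
  derivatives of f in the same way.\<close>

lemma C_k_bounded_linear_compose:
  assumes "bounded_linear L"
  shows "C_k k f \<Longrightarrow> C_k k (\<lambda>x. L (f x))"
proof (induction k arbitrary: f)
  case 0
  then show ?case
    using assms by (auto intro: bounded_linear.continuous_on)
next
  case (Suc k)
  show ?case
    by (rule C_k_Suc_I[OF bounded_linear.has_derivative[OF assms C_k_Suc_D(1)[OF Suc.prems]]])
      (intro Suc.IH C_k_Suc_D(2)[OF Suc.prems])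
qed

lemma C_k_affine_compose:
  assumes "bounded_linear A"
  shows "C_k k f \<Longrightarrow> C_k k (\<lambda>x. f (A x + c))"
proof (induction k arbitrary: f)
  case 0
  have "continuous_on UNIV (\<lambda>x. A x + c)"
    using assms by (intro continuous_intros bounded_linear.continuous_on[OF assms])
  then show ?case
    using 0 continuous_on_compose2[of UNIV f UNIV "\<lambda>x. A x + c"] by auto
next
  case (Suc k)
  have A: "((\<lambda>x. A x + c) has_derivative A) (at x)" for x
    using bounded_linear_imp_has_derivative[OF assms] by (auto intro!: derivative_eq_intros)
  have "((\<lambda>x. f (A x + c)) has_derivative (\<lambda>u. frechet_derivative f (at (A x + c)) (A u))) (at x)" for x
    using has_derivative_compose[OF A C_k_Suc_D(1)[OF Suc.prems]] by simp
  then show ?case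
    by (rule C_k_Suc_I) (rule Suc.IH[OF C_k_Suc_D(2)[OF Suc.prems]])
qed

lemma C_k_const: "C_k k (\<lambda>x. c)"
proof (induction k arbitrary: c)
  case (Suc k)
  show ?case
    by (rule C_k_Suc_I[OF has_derivative_const]) (rule Suc)
qed auto

lemma C_k_add: "C_k k f \<Longrightarrow> C_k k g \<Longrightarrow> C_k k (\<lambda>x. f x + g x)"
proof (induction k arbitrary: f g)
  case 0
  then show ?case by (auto intro: continuous_intros)
next
  case (Suc k)
  show ?case
    by (rule C_k_Suc_I[OF has_derivative_add[OF C_k_Suc_D(1)[OF Suc.prems(1)] C_k_Suc_D(1)[OF Suc.prems(2)]]])
      (intro Suc.IH C_k_Suc_D(2)[OF Suc.prems(1)] C_k_Suc_D(2)[OF Suc.prems(2)])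
qed

text \<open>The product rule leaves one factor undifferentiated in each term;
  \<open>C_k_lower\<close> makes these factors available to the induction hypothesis.\<close>

lemma C_k_scaleR: "C_k k f \<Longrightarrow> C_k k g \<Longrightarrow> C_k k (\<lambda>x. f x *\<^sub>R g x)"
proof (induction k arbitrary: f g)
  case 0
  then show ?case by (auto intro: continuous_intros)
next
  case (Suc k)
  show ?case
    by (rule C_k_Suc_I[OF has_derivative_scaleR[OF C_k_Suc_D(1)[OF Suc.prems(1)] C_k_Suc_D(1)[OF Suc.prems(2)]]])
      (intro C_k_add Suc.IH C_k_Suc_D(2)[OF Suc.prems(1)] C_k_Suc_D(2)[OF Suc.prems(2)]
        C_k_lower[OF Suc.prems(1)] C_k_lower[OF Suc.prems(2)])
qed

lemma C_k_mult:
  fixes f g :: "'a::real_normed_vector \<Rightarrow> real"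
  shows "C_k k f \<Longrightarrow> C_k k g \<Longrightarrow> C_k k (\<lambda>x. f x * g x)"
  using C_k_scaleR[of k f g] by simp

lemma C_k_prod:
  fixes f :: "'i \<Rightarrow> 'a::real_normed_vector \<Rightarrow> real"
  shows "(\<And>i. i \<in> I \<Longrightarrow> C_k k (f i)) \<Longrightarrow> C_k k (\<lambda>x. \<Prod>i\<in>I. f i x)"
  by (induction I rule: infinite_finite_induct) (auto intro: C_k_mult C_k_const)

text \<open>The derivative of 1/f contains 1/f itself, so the induction hypothesis for the same f,
  one order lower, closes the argument.\<close>

lemma C_k_inverse:
  fixes f :: "'a::real_normed_vector \<Rightarrow> real"
  assumes nz: "\<And>x. f x \<noteq> 0"
  shows "C_k k f \<Longrightarrow> C_k k (\<lambda>x. inverse (f x))"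
proof (induction k)
  case 0
  then show ?case using nz by (auto intro: continuous_intros)
next
  case (Suc k)
  have "C_k k (\<lambda>x. inverse (f x))"
    using Suc C_k_lower by blast
  then have "C_k k (\<lambda>x. - (inverse (f x) * frechet_derivative f (at x) u * inverse (f x)))" for u
    by (intro C_k_bounded_linear_compose[OF bounded_linear_minus[OF bounded_linear_ident]]
        C_k_mult C_k_Suc_D(2)[OF Suc.prems])
  then show ?case
    by (intro C_k_Suc_I[where f'="\<lambda>x u. - (inverse (f x) * frechet_derivative f (at x) u * inverse (f x))"]
        Deriv.has_derivative_inverse[OF nz C_k_Suc_D(1)[OF Suc.prems]])
qed

lemma smooth_has_derivative:
  "smooth f \<Longrightarrow> (f has_derivative frechet_derivative f (at x)) (at x)"
  using C_k_Suc_D(1) unfolding smooth_def by blast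

lemma smooth_frechet_derivative:
  "smooth f \<Longrightarrow> smooth (\<lambda>x. frechet_derivative f (at x) u)"
  using C_k_Suc_D(2) unfolding smooth_def by blast

lemma smooth_imp_continuous_on: "smooth f \<Longrightarrow> continuous_on UNIV f"
  unfolding smooth_def by (metis C_k.simps(1))

text \<open>A property that reproduces itself under directional derivatives can be unfolded to any
  order, so no formula for higher derivatives is required. Its use is for periodizations, whose
  derivatives are again periodizations.\<close>

lemma smooth_coinduct:
  assumes "P f"
    and "\<And>f. P f \<Longrightarrow>
      \<exists>f'. (\<forall>x. (f has_derivative f' x) (at x)) \<and> (\<forall>u. P (\<lambda>x. f' x u))"
  shows "smooth f"
proof -
  have cont: "continuous_on UNIV f" if Pf: "P f" for f
  proof -
    obtain f' where "\<And>x. (f has_derivative f' x) (at x)"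
      using assms(2)[OF Pf] by blast
    then show ?thesis
      by (intro continuous_at_imp_continuous_on ballI has_derivative_continuous)
  qed
  have "P f \<Longrightarrow> C_k k f" for k f
  proof (induction k arbitrary: f)
    case 0
    then show ?case by (simp add: cont)
  next
    case (Suc k)
    then obtain f' where "\<And>x. (f has_derivative f' x) (at x)" "\<And>u. P (\<lambda>x. f' x u)"
      using assms(2) by blast
    then show ?case by (intro C_k_Suc_I Suc.IH)
  qed
  then show ?thesis
    using assms(1) by (auto simp: smooth_def)
qed

section \<open>A smooth step built from exp(-1/x)\<close>

definition flat :: "nat \<Rightarrow> real \<Rightarrow> real" where
  "flat k x = (if x > 0 then inverse x ^ k * exp (- inverse x) else 0)"

lemma flat_tendsto_0: "(flat k \<longlongrightarrow> 0) (at_right 0)"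
proof -
  have "((\<lambda>x. x ^ k / exp x) \<longlongrightarrow> (0::real)) at_top"
    by (rule tendsto_power_div_exp_0)
  then have "((\<lambda>x. inverse x ^ k / exp (inverse x)) \<longlongrightarrow> (0::real)) (at_right 0)"
    using filterlim_compose[OF _ filterlim_inverse_at_top_right] by blast
  moreover have "\<forall>\<^sub>F x in at_right (0::real). inverse x ^ k / exp (inverse x) = flat k x"
    by (auto simp: eventually_at_right_less flat_def exp_minus divide_inverse
        intro: eventually_mono[OF eventually_at_right_less])
  ultimately show ?thesis
    by (simp add: tendsto_cong)
qed

text \<open>The powers of 1/x are part of \<open>flat\<close> so that the family is closed under
  differentiation up to linear combinations; smoothness of exp(-1/x), extended by zero, then follows
  by one induction over the whole family.\<close>

lemma DERIV_flat: "DERIV (flat k) x :> flat (k + 2) x - of_nat k * flat (k + 1) x"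
proof -
  consider "x > 0" | "x < 0" | "x = 0" by linarith
  then show ?thesis
  proof cases
    case 1
    have "DERIV (\<lambda>x. inverse x ^ k * exp (- inverse x)) x :> flat (k + 2) x - of_nat k * flat (k + 1) x"
      using 1 by (auto intro!: derivative_eq_intros simp: flat_def field_simps power2_eq_square)
        (cases k; simp add: field_simps)
    moreover have "\<forall>\<^sub>F y in nhds x. flat k y = inverse y ^ k * exp (- inverse y)"
      using eventually_nhds_in_open[of "{0<..}" x] 1 by (auto elim!: eventually_mono simp: flat_def)
    ultimately show ?thesis
      by (subst DERIV_cong_ev[OF refl _ refl])
  next
    case 2
    have "DERIV (\<lambda>x. 0) x :> flat (k + 2) x - of_nat k * flat (k + 1) x"
      using 2 by (auto simp: flat_def)
    moreover have "\<forall>\<^sub>F y in nhds x. flat k y = 0"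
      using eventually_nhds_in_open[of "{..<0}" x] 2 by (auto elim!: eventually_mono simp: flat_def)
    ultimately show ?thesis
      by (subst DERIV_cong_ev[OF refl _ refl])
  next
    case 3
    \<comment> \<open>For positive h the difference quotient at 0 is \<open>flat (Suc k) h\<close>,
      again a member of the family.\<close>
    have "((\<lambda>h. flat k h / h) \<longlongrightarrow> 0) (at_right 0)"
      by (rule Lim_transform_eventually[OF flat_tendsto_0[of "Suc k"]])
        (auto simp: flat_def field_simps intro: eventually_mono[OF eventually_at_right_less])
    moreover have "((\<lambda>h. flat k h / h) \<longlongrightarrow> 0) (at_left 0)"
      by (rule Lim_transform_eventually[OF tendsto_const])
        (auto simp: flat_def not_less eventually_at_filter)
    ultimately have "((\<lambda>h. flat k h / h) \<longlongrightarrow> 0) (at 0)"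
      by (simp add: filterlim_split_at)
    then show ?thesis
      using 3 by (simp add: DERIV_def flat_def)
  qed
qed

lemma C_k_flat: "C_k j (flat k)"
proof (induction j arbitrary: k)
  case 0
  show ?case
    using DERIV_flat[of k] DERIV_continuous[of "flat k"]
    by (auto intro!: continuous_at_imp_continuous_on)
next
  case (Suc j)
  show ?case
  proof (rule C_k_Suc_I)
    show "(flat k has_derivative (\<lambda>u. (flat (k + 2) x + (- of_nat k) * flat (k + 1) x) * u)) (at x)" for x
      using DERIV_flat[of k x] by (simp add: has_field_derivative_def)
    show "C_k j (\<lambda>x. (flat (k + 2) x + (- of_nat k) * flat (k + 1) x) * u)" for u
      by (intro C_k_mult C_k_add C_k_const Suc)
  qed
qed

lemma smooth_step_exists:
  obtains s :: "real \<Rightarrow> real" and s' and K where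
    "smooth s" "\<And>t. 0 \<le> s t" "\<And>t. s t \<le> 1" "\<And>t. t \<le> 0 \<Longrightarrow> s t = 0" "\<And>t. t \<ge> 1 \<Longrightarrow> s t = 1"
    "\<And>t. (s has_real_derivative s' t) (at t)" "\<And>t. \<bar>s' t\<bar> \<le> K"
proof -
  \<comment> \<open>One of t and 1 - t is always positive, so d never vanishes, and the quotient of
    \<open>flat 0 t\<close> by d rises from 0 to 1 across the unit interval.\<close>
  define d where "d t = flat 0 t + flat 0 (1 - t)" for t
  define s where "s t = flat 0 t * inverse (d t)" for t
  have d: "d t > 0" for t
    by (auto simp: d_def flat_def intro: add_pos_pos)
  have flat1: "C_k k (\<lambda>t. flat 0 (1 - t))" for k
    using C_k_affine_compose[OF bounded_linear_minus[OF bounded_linear_ident] C_k_flat, of k 0 1]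
    by simp
  have sm: "smooth s"
    unfolding smooth_def s_def using d
    by (intro allI C_k_mult C_k_inverse C_k_flat)
      (auto simp: d_def less_imp_neq[symmetric] intro!: C_k_add C_k_flat flat1)
  define s' where "s' t = frechet_derivative s (at t) 1" for t
  have der: "(s has_real_derivative s' t) (at t)" for t
  proof -
    have d: "(s has_derivative frechet_derivative s (at t)) (at t)"
      by (rule smooth_has_derivative[OF sm])
    have "frechet_derivative s (at t) u = u * s' t" for u
      using linear_scale[OF bounded_linear.linear[OF has_derivative_bounded_linear[OF d]], of u 1]
      by (simp add: s'_def)
    then show ?thesis
      unfolding has_field_derivative_def
      by (intro has_derivative_eq_rhs[OF d]) (simp add: fun_eq_iff mult.commute)
  qed
  have "continuous_on UNIV s'"
    using smooth_imp_continuous_on[OF smooth_frechet_derivative[OF sm]] by (simp add: s'_def[abs_def])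
  then have "compact (s' ` {0..1})"
    by (intro compact_continuous_image) (auto intro: continuous_on_subset)
  then obtain K where K: "\<And>t. t \<in> {0..1} \<Longrightarrow> \<bar>s' t\<bar> \<le> K"
    using compact_imp_bounded[of "s' ` {0..1}"] unfolding bounded_iff by (auto simp del: atLeastAtMost_iff)
  have s0: "s t = 0" if "t \<le> 0" for t
    using that by (simp add: s_def flat_def)
  have s1: "s t = 1" if "t \<ge> 1" for t
    using that by (simp add: s_def d_def flat_def)
  \<comment> \<open>Outside the unit interval s is locally constant, so the bound obtained by
    compactness inside it holds everywhere.\<close>
  have K2: "\<bar>s' t\<bar> \<le> K" for t
  proof (cases "t \<in> {0..1}")
    case False
    have "s' t = 0"
    proof (cases "t < 0")
      case True
      then have "\<forall>\<^sub>F y in nhds t. s y = 0"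
        using eventually_nhds_in_open[of "{..<0}" t] s0 by (auto elim!: eventually_mono)
      then have "(s has_real_derivative 0) (at t)"
        by (subst DERIV_cong_ev[OF refl _ refl]) auto
      then show ?thesis using der DERIV_unique by blast
    next
      case f: False
      then have "\<forall>\<^sub>F y in nhds t. s y = 1"
        using False eventually_nhds_in_open[of "{1<..}" t] s1 by (auto elim!: eventually_mono)
      then have "(s has_real_derivative 0) (at t)"
        by (subst DERIV_cong_ev[OF refl _ refl]) auto
      then show ?thesis using der DERIV_unique by blast
    qed
    then show ?thesis using K[of 0] by force
  qed (use K in blast)
  have flat0: "0 \<le> flat 0 t" for t
    by (simp add: flat_def)
  have "0 \<le> s t" for t
    unfolding s_def using flat0[of t] d[of t] by simp
  moreover have "s t \<le> 1" for t
    unfolding s_def divide_inverse[symmetric] divide_le_eq_1_pos[OF d]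
    using flat0[of "1 - t"] by (simp add: d_def)
  ultimately show ?thesis
    by (intro that[of s s' K] sm s0 s1 der K2)
qed

section \<open>Lebesgue measure under affine maps\<close>

text \<open>Shears and coordinate swaps are two of the elementary maps into which
  \<open>induct_linear_elementary\<close> decomposes a linear map; they preserve volume, so their
  determinants must have absolute value one.\<close>

lemma det_shear:
  fixes m n :: "'n::finite"
  assumes "m \<noteq> n"
  shows "det (matrix (\<lambda>v::real^'n. \<chi> i. if i = m then v $ m + v $ n else v $ i)) = 1"
proof -
  have "matrix (\<lambda>v::real^'n. \<chi> i. if i = m then v $ m + v $ n else v $ i) =
      (\<chi> k. if k = m then row m (mat 1) + 1 *s row n (mat 1) else row k (mat 1 :: real^'n^'n))"
    by (auto simp: vec_eq_iff matrix_def row_def mat_def axis_def)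
  then show ?thesis
    using det_row_operation[OF assms, of "mat 1" 1] by simp
qed

lemma det_swap_coordinates:
  fixes m n :: "'n::finite"
  shows "\<bar>det (matrix (\<lambda>v::real^'n. \<chi> i. v $ Transposition.transpose m n i))\<bar> = 1"
proof -
  have "matrix (\<lambda>v::real^'n. \<chi> i. v $ Transposition.transpose m n i) =
      (\<chi> i. (mat 1 :: real^'n^'n) $ Transposition.transpose m n i)"
    by (auto simp: vec_eq_iff matrix_def mat_def axis_def)
  then show ?thesis
    by (simp add: det_permute_rows permutes_swap_id sign_swap_id abs_mult)
qed

text \<open>The library proves this only for index types that carry a well-order.\<close>

lemma measure_linear_image_finite:
  fixes f :: "real^'n \<Rightarrow> real^'n"
  assumes "linear f"
  shows "\<forall>S\<in>lmeasurable. f ` S \<in> lmeasurable \<and>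
    measure lebesgue (f ` S) = \<bar>det (matrix f)\<bar> * measure lebesgue S"
  using assms
proof (induction f rule: induct_linear_elementary)
  case (2 f g)
  show ?case
  proof
    fix S :: "(real^'n) set"
    assume "S \<in> lmeasurable"
    then have "(f \<circ> g) ` S \<in> lmeasurable \<and>
        measure lebesgue ((f \<circ> g) ` S) = \<bar>det (matrix f)\<bar> * (\<bar>det (matrix g)\<bar> * measure lebesgue S)"
      using 2(3)[OF 2(1)] 2(4)[OF 2(2)] unfolding image_comp[symmetric] by metis
    then show "(f \<circ> g) ` S \<in> lmeasurable \<and>
        measure lebesgue ((f \<circ> g) ` S) = \<bar>det (matrix (f \<circ> g))\<bar> * measure lebesgue S"
      by (simp add: matrix_compose[OF 2(2,1)] det_mul abs_mult)
  qed
next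
  \<comment> \<open>A map with an identically vanishing coordinate is not surjective, hence
    singular: the image is negligible and the determinant is zero.\<close>
  case (3 f i)
  have "\<not> inj f"
    using 3 by (metis linear_injective_imp_surjective one_neq_zero surjE vec_component)
  then show ?case
    using negligible_linear_singular_image[OF \<open>linear f\<close>] det_nz_iff_inj[OF \<open>linear f\<close>]
    by (simp add: negligible_iff_measure)
next
  case (4 c)
  have "matrix (\<lambda>x. \<chi> i. c i * x $ i) $ i $ j = 0" if "i \<noteq> j" for i j :: 'n
    using that by (simp add: matrix_def axis_def)
  then have "det (matrix (\<lambda>x::real^'n. \<chi> i. c i * x $ i)) = prod c UNIV"
    by (subst det_diagonal) (auto simp: matrix_def axis_def)
  then show ?case
    by (simp add: measurable_stretch measure_stretch)
next
  case (5 m n)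
  let ?h = "\<lambda>v::real^'n. \<chi> i. v $ Transposition.transpose m n i"
  have lin: "linear ?h"
    by (rule linearI) (simp_all add: vec_eq_iff)
  have "measure lebesgue (?h ` cbox a b) = measure lebesgue (cbox a b)" for a b
  proof (cases "cbox a b = {}")
    case False
    have "?h ` cbox a b = cbox (?h a) (?h b)"
    proof
      show "cbox (?h a) (?h b) \<subseteq> ?h ` cbox a b"
      proof
        fix x assume x: "x \<in> cbox (?h a) (?h b)"
        have "?h x \<in> cbox a b"
          using x by (auto simp: mem_box_cart) (metis transpose_involutory)+
        moreover have "x = ?h (?h x)"
          by (simp add: vec_eq_iff)
        ultimately show "x \<in> ?h ` cbox a b" by blast
      qed
    qed (auto simp: mem_box_cart)
    moreover from this False have "cbox (?h a) (?h b) \<noteq> {}"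
      by auto
    moreover have "(\<Prod>i\<in>UNIV. (b - a) $ Transposition.transpose m n i) = (\<Prod>i\<in>UNIV. (b - a) $ i)"
      using prod.permute[OF permutes_swap_id[of m UNIV n], of "\<lambda>i. (b - a) $ i"] by (simp add: o_def)
    ultimately show ?thesis
      using False by (simp add: content_cbox_cart)
  qed simp
  then have im: "measure lebesgue (?h ` cbox a b) = 1 * measure lebesgue (cbox a b)" for a b
    by simp
  have d: "\<bar>det (matrix ?h)\<bar> = 1"
    using det_swap_coordinates[of m n] by simp
  show ?case
    unfolding d by (intro ballI conjI measure_linear_sufficient[OF lin _ im, THEN conjunct1]
        measure_linear_sufficient[OF lin _ im, THEN conjunct2, symmetric])
next
  case (6 m n)
  let ?h = "\<lambda>v::real^'n. \<chi> i. if i = m then v $ m + v $ n else v $ i"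
  have lin: "linear ?h"
    by (rule linearI) (auto simp: vec_eq_iff algebra_simps)
  have "measure lebesgue (?h ` cbox a b) = measure lebesgue (cbox a b)" for a b
  proof (cases "cbox a b = {}")
    case False
    \<comment> \<open>\<open>measure_shear_interval\<close> wants a box whose lower bound in
      coordinate n is non-negative; translating by v makes that bound zero.\<close>
    define v where "v = axis n (a $ n)"
    have box: "cbox a b = (+) v ` cbox (a - v) (b - v)"
      by (simp add: cbox_translation[symmetric])
    have "?h ` cbox a b = (+) (?h v) ` ?h ` cbox (a - v) (b - v)"
      unfolding box image_image by (intro image_cong) (auto simp: vec_eq_iff)
    then have "measure lebesgue (?h ` cbox a b) = measure lebesgue (?h ` cbox (a - v) (b - v))"
      by (simp only: measure_translation)
    also have "\<dots> = measure lebesgue (cbox (a - v) (b - v))"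
      using False box by (intro measure_shear_interval 6(1)) (auto simp: v_def)
    also have "\<dots> = measure lebesgue (cbox a b)"
      unfolding box by (simp only: measure_translation)
    finally show ?thesis .
  qed simp
  then have im: "measure lebesgue (?h ` cbox a b) = 1 * measure lebesgue (cbox a b)" for a b
    by simp
  have d: "\<bar>det (matrix ?h)\<bar> = 1"
    using det_shear[OF 6(1)] by simp
  show ?case
    unfolding d by (intro ballI conjI measure_linear_sufficient[OF lin _ im, THEN conjunct1]
        measure_linear_sufficient[OF lin _ im, THEN conjunct2, symmetric])
qed (fact assms)

lemma abs_det_one_inverse:
  fixes A :: "real^'n^'n"
  assumes "\<bar>det A\<bar> = 1"
  obtains B where "A ** B = mat 1" "B ** A = mat 1" "\<bar>det B\<bar> = 1"
proof -
  obtain B where B: "A ** B = mat 1" "B ** A = mat 1"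
    using assms invertible_det_nz[of A] unfolding invertible_def by auto
  have "\<bar>det A * det B\<bar> = 1"
    unfolding det_mul[symmetric] B by simp
  then have "\<bar>det B\<bar> = 1"
    using assms by (simp add: abs_mult)
  then show ?thesis
    using that B by blast
qed

lemma matrix_vector_image_lebesgue:
  fixes A :: "real^'n^'n"
  assumes "S \<in> sets lebesgue"
  shows "(\<lambda>x. c + A *v x) ` S \<in> sets lebesgue"
proof (rule differentiable_image_in_sets_lebesgue[OF assms order_refl])
  show "(\<lambda>x. c + A *v x) differentiable_on S"
    by (intro differentiable_at_imp_differentiable_on
        differentiable_add[OF differentiable_const linear_imp_differentiable[OF matrix_vector_mul_linear]])
qed

lemma emeasure_affine_image:
  fixes A :: "real^'n^'n"
  assumes S: "S \<in> sets lebesgue" and d: "\<bar>det A\<bar> = 1"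
  shows "emeasure lebesgue ((\<lambda>x. c + A *v x) ` S) = emeasure lebesgue S"
proof -
  have fin: "(\<lambda>x. c + A *v x) ` S \<in> lmeasurable \<and>
      measure lebesgue ((\<lambda>x. c + A *v x) ` S) = measure lebesgue S"
    if "S \<in> lmeasurable" "\<bar>det A\<bar> = 1" for c S and A :: "real^'n^'n"
  proof -
    have "(\<lambda>x. c + A *v x) ` S = (+) c ` (*v) A ` S"
      by (simp add: image_image)
    then show ?thesis
      using measure_linear_image_finite[OF matrix_vector_mul_linear, of A] that
      by (simp add: measure_translation measurable_translation)
  qed
  show ?thesis
  proof (cases "S \<in> lmeasurable")
    case True
    then show ?thesis
      using fin[OF True d] by (simp add: emeasure_eq_measure2 fmeasurableD2)
  next
    case False
    \<comment> \<open>Infinite measure cannot become finite: the inverse map also has determinant of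
      absolute value one and would carry the finite measure back to S.\<close>
    have "(\<lambda>x. c + A *v x) ` S \<notin> lmeasurable"
    proof
      assume *: "(\<lambda>x. c + A *v x) ` S \<in> lmeasurable"
      obtain B where inv: "B ** A = mat 1" and "\<bar>det B\<bar> = 1"
        using abs_det_one_inverse[OF d] by blast
      then have "(\<lambda>x. B *v (- c) + B *v x) ` (\<lambda>x. c + A *v x) ` S \<in> lmeasurable"
        using fin[OF *] by blast
      also have "(\<lambda>x. B *v (- c) + B *v x) ` (\<lambda>x. c + A *v x) ` S = S"
        by (simp add: image_image matrix_vector_mult_add_rdistrib matrix_vector_mul_assoc inv
            matrix_vector_right_distrib linear_neg[OF matrix_vector_mul_linear])
      finally show False using False by simp
    qed
    then show ?thesis
      using False S matrix_vector_image_lebesgue[OF S, of c A]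
      by (metis fmeasurableI infinity_ennreal_def top.not_eq_extremum)
  qed
qed

text \<open>Preimages under the map are images under its inverse, which is affine with a matrix of
  the same kind, so the result on images gives invariance of the measure. Stated for
  \<open>distr\<close>, it serves both integrals and null sets.\<close>

lemma distr_lebesgue_affine:
  fixes A :: "real^'n^'n"
  assumes d: "\<bar>det A\<bar> = 1"
  shows "(\<lambda>x. c + A *v x) \<in> lebesgue \<rightarrow>\<^sub>M lebesgue"
    and "distr lebesgue lebesgue (\<lambda>x. c + A *v x) = lebesgue"
proof -
  obtain B where inv: "A ** B = mat 1" "B ** A = mat 1" and dB: "\<bar>det B\<bar> = 1"
    using abs_det_one_inverse[OF d] by blast
  have vim: "(\<lambda>x. c + A *v x) -` S = (\<lambda>x. B *v (- c) + B *v x) ` S" for S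
  proof (intro equalityI subsetI)
    fix x assume "x \<in> (\<lambda>x. c + A *v x) -` S"
    moreover have "x = B *v (- c) + B *v (c + A *v x)"
      by (simp add: matrix_vector_right_distrib matrix_vector_mul_assoc inv
          linear_neg[OF matrix_vector_mul_linear])
    ultimately show "x \<in> (\<lambda>x. B *v (- c) + B *v x) ` S"
      by blast
  next
    fix x assume "x \<in> (\<lambda>x. B *v (- c) + B *v x) ` S"
    then show "x \<in> (\<lambda>x. c + A *v x) -` S"
      by (auto simp: matrix_vector_right_distrib matrix_vector_mult_diff_distrib matrix_vector_mul_assoc inv
          linear_neg[OF matrix_vector_mul_linear])
  qed
  show m: "(\<lambda>x. c + A *v x) \<in> lebesgue \<rightarrow>\<^sub>M lebesgue"
    by (rule measurableI) (auto simp: vim intro!: matrix_vector_image_lebesgue)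
  show "distr lebesgue lebesgue (\<lambda>x. c + A *v x) = lebesgue"
    by (rule measure_eqI) (auto simp: emeasure_distr[OF m] vim emeasure_affine_image dB)
qed

lemma nn_integral_lebesgue_affine:
  fixes A :: "real^'n^'n"
  assumes "\<bar>det A\<bar> = 1" and "f \<in> borel_measurable lebesgue"
  shows "(\<integral>\<^sup>+x. f (c + A *v x) \<partial>lebesgue) = (\<integral>\<^sup>+x. f x \<partial>lebesgue)"
  using nn_integral_distr[OF distr_lebesgue_affine(1)[OF assms(1)], of f c]
    distr_lebesgue_affine(2)[OF assms(1), of c] assms(2) by simp

lemma nn_integral_lebesgue_translate:
  fixes f :: "real^'n \<Rightarrow> ennreal"
  assumes "f \<in> borel_measurable lebesgue"
  shows "(\<integral>\<^sup>+x. f (x + c) \<partial>lebesgue) = (\<integral>\<^sup>+x. f x \<partial>lebesgue)"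
  using nn_integral_lebesgue_affine[of "mat 1" f c] assms by (simp add: add.commute)

lemma measurable_lebesgue_translate:
  fixes f :: "real^'n \<Rightarrow> 'b::topological_space"
  assumes "f \<in> borel_measurable lebesgue"
  shows "(\<lambda>x. f (x + c)) \<in> borel_measurable lebesgue"
  using measurable_compose[OF distr_lebesgue_affine(1)[of "mat 1" c] assms] by (simp add: add.commute)

section \<open>Lattice coordinates and tilings\<close>

lemma periodic_int_multiple:
  assumes "periodic b f"
  shows "f (x + of_int k *\<^sub>R b i) = f x"
proof (induction k rule: int_induct[where k = 0])
  case base
  then show ?case by simp
next
  case (step1 k)
  have "f (x + of_int (k + 1) *\<^sub>R b i) = f ((x + of_int k *\<^sub>R b i) + b i)"
    by (simp add: algebra_simps)
  then show ?case
    using assms step1 unfolding periodic_def by metis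
next
  case (step2 k)
  have "f (x + of_int k *\<^sub>R b i) = f ((x + of_int (k - 1) *\<^sub>R b i) + b i)"
    by (simp add: algebra_simps)
  then show ?case
    using assms step2 unfolding periodic_def by metis
qed

locale lattice_cell =
  fixes p :: "real^'n" and b :: "'n \<Rightarrow> real^'n"
  assumes inj_b: "inj b" and independent_b: "independent (range b)"
begin

abbreviation cell :: "(real^'n) set" where "cell \<equiv> unit_cell p b"

definition comb :: "real^'n \<Rightarrow> real^'n" where
  "comb t = (\<Sum>i\<in>UNIV. t $ i *\<^sub>R b i)"

definition lin_coord :: "real^'n \<Rightarrow> real^'n" where
  "lin_coord = inv comb"

text \<open>Lattice coordinates relative to the corner of the cell, inverse to
  \<open>p + comb t\<close>: the cell becomes the half-open unit cube, and adding
  \<open>lat m\<close> becomes the integer shift by m.\<close>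

definition coord :: "real^'n \<Rightarrow> real^'n" where
  "coord x = lin_coord (x - p)"

definition lat :: "('n \<Rightarrow> int) \<Rightarrow> real^'n" where
  "lat m = (\<Sum>i\<in>UNIV. of_int (m i) *\<^sub>R b i)"

text \<open>The label of a tile: x lies in the translate of the cell by \<open>lat (idx x)\<close>
  and in no other lattice translate.\<close>

definition idx :: "real^'n \<Rightarrow> 'n \<Rightarrow> int" where
  "idx x i = \<lfloor>coord x $ i\<rfloor>"

definition block :: "real \<Rightarrow> real \<Rightarrow> (real^'n) set" where
  "block r s = {x. \<forall>i. r \<le> coord x $ i \<and> coord x $ i < s}"

lemma linear_comb: "linear comb"
  unfolding comb_def by (rule linearI) (auto simp: algebra_simps sum.distrib scaleR_sum_right)

text \<open>Independence speaks of the set \<open>range b\<close>, while \<open>comb\<close> sums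
  over indices; injectivity of b lets the coefficients be carried over to the set.\<close>

lemma inj_comb: "inj comb"
  unfolding linear_injective_0[OF linear_comb]
proof (intro allI impI)
  fix t assume 0: "comb t = 0"
  have "(\<Sum>v\<in>range b. t $ inv b v *\<^sub>R v) = comb t"
    unfolding comb_def by (subst sum.reindex[OF inj_b]) (simp add: inv_f_f[OF inj_b])
  then have "t $ inv b (b i) = 0" for i
    using independentD[OF independent_b finite_imageI[OF finite] subset_refl, of "\<lambda>v. t $ inv b v"] 0
    by simp
  then show "t = 0"
    by (simp add: vec_eq_iff inv_f_f[OF inj_b])
qed

lemma comb_lin_coord [simp]: "comb (lin_coord x) = x"
  unfolding lin_coord_def
  by (rule surj_f_inv_f[OF linear_inj_imp_surj[OF linear_comb inj_comb]])

lemma lin_coord_comb [simp]: "lin_coord (comb t) = t"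
  unfolding lin_coord_def by (rule inv_f_f[OF inj_comb])

lemma linear_lin_coord: "linear lin_coord"
proof (rule linearI)
  show "lin_coord (x + y) = lin_coord x + lin_coord y" for x y
    using injD[OF inj_comb] linear_add[OF linear_comb] by (metis comb_lin_coord)
  show "lin_coord (r *\<^sub>R x) = r *\<^sub>R lin_coord x" for r x
    using injD[OF inj_comb] linear_scale[OF linear_comb] by (metis comb_lin_coord)
qed

lemma coord_add: "coord (x + y) = coord x + lin_coord y"
  unfolding coord_def linear_add[OF linear_lin_coord, symmetric] by (simp add: algebra_simps)

lemma coord_diff: "coord x - coord y = lin_coord (x - y)"
  unfolding coord_def linear_diff[OF linear_lin_coord, symmetric] by simp

lemma coord_comb: "coord (p + comb t) = t"
  by (simp add: coord_def)

lemma comb_coord: "p + comb (coord x) = x"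
  by (simp add: coord_def)

lemma lat_comb: "lat m = comb (\<chi> i. of_int (m i))"
  by (simp add: lat_def comb_def)

lemma coord_add_lat: "coord (x + lat m) $ i = coord x $ i + of_int (m i)"
  by (simp add: coord_add lat_comb)

lemma idx_add_lat: "idx (x + lat m) = (\<lambda>i. idx x i + m i)"
  by (simp add: idx_def fun_eq_iff coord_add_lat)

lemma cell_eq_block: "cell = block 0 1"
proof (intro equalityI subsetI)
  fix x assume "x \<in> cell"
  then obtain t where "x = p + comb (\<chi> i. t i)" "\<forall>i. 0 \<le> t i \<and> t i < 1"
    by (auto simp: unit_cell_def comb_def)
  then show "x \<in> block 0 1"
    by (simp add: block_def coord_comb)
next
  fix x assume "x \<in> block 0 1"
  then have "\<forall>i. 0 \<le> coord x $ i \<and> coord x $ i < 1"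
    by (simp add: block_def)
  moreover have "x = p + (\<Sum>i\<in>UNIV. coord x $ i *\<^sub>R b i)"
    using comb_coord[of x] by (simp add: comb_def)
  ultimately show "x \<in> cell"
    unfolding unit_cell_def by blast
qed

lemma cell_iff_idx: "x \<in> cell \<longleftrightarrow> idx x = (\<lambda>_. 0)"
  by (simp add: cell_eq_block block_def idx_def fun_eq_iff floor_eq_iff)

lemma reduce_in_cell: "x + lat (\<lambda>i. - idx x i) \<in> cell"
  by (simp add: cell_iff_idx idx_add_lat)

lemma lin_coord_bound: "\<exists>K>0. \<forall>x i. \<bar>lin_coord x $ i\<bar> \<le> K * norm x"
proof -
  obtain K where "K > 0" "\<And>x. norm (lin_coord x) \<le> K * norm x"
    using linear_bounded_pos[OF linear_lin_coord] by blast
  then show ?thesis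
    by (metis component_le_norm_cart order_trans)
qed

section \<open>Measurability and volume of cells and blocks\<close>

lemma continuous_on_coord: "continuous_on S coord"
  unfolding coord_def
  by (intro continuous_on_compose2[OF linear_continuous_on[OF linear_conv_bounded_linear[THEN iffD1, OF linear_lin_coord]]]
      continuous_intros) auto

lemma continuous_on_coord_nth: "continuous_on S (\<lambda>x. coord x $ i)"
  by (intro continuous_on_component continuous_on_coord)

lemma coord_borel [measurable]: "(\<lambda>x. coord x $ i) \<in> borel_measurable borel"
  by (intro borel_measurable_continuous_onI continuous_on_coord_nth)

lemma block_sets_borel: "block r s \<in> sets borel"
  unfolding block_def by measurable

lemma idx_sets_borel: "{x. idx x = m} \<in> sets borel"
proof -
  have "{x. idx x = m} = {x. \<forall>i. of_int (m i) \<le> coord x $ i \<and> coord x $ i < of_int (m i) + 1}"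
    by (auto simp: idx_def fun_eq_iff floor_eq_iff)
  also have "\<dots> \<in> sets borel"
    by measurable
  finally show ?thesis .
qed

lemma borel_in_lebesgue: "S \<in> sets borel \<Longrightarrow> S \<in> sets lebesgue"
  by (metis sets_completionI_sets sets_lborel)

lemma bounded_block: "bounded (block r s)"
proof -
  have "block r s \<subseteq> (\<lambda>t. p + comb t) ` cbox (\<chi> i. r) (\<chi> i. s)"
  proof
    fix x assume "x \<in> block r s"
    then have "coord x \<in> cbox (\<chi> i. r) (\<chi> i. s)"
      by (auto simp: block_def mem_box_cart less_imp_le)
    then show "x \<in> (\<lambda>t. p + comb t) ` cbox (\<chi> i. r) (\<chi> i. s)"
      using comb_coord[of x] by (metis imageI)
  qed
  moreover have "bounded ((\<lambda>t. p + comb t) ` cbox (\<chi> i. r) (\<chi> i. s))"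
    using bounded_translation[OF bounded_linear_image[OF bounded_cbox linear_conv_bounded_linear[THEN iffD1, OF linear_comb]], of p]
    by (simp add: image_image)
  ultimately show ?thesis
    using bounded_subset by blast
qed

lemma bounded_cell: "bounded cell"
  by (simp add: cell_eq_block bounded_block)

lemma cell_lebesgue [measurable]: "cell \<in> sets lebesgue"
  by (simp add: cell_eq_block block_sets_borel borel_in_lebesgue)

lemma cell_lmeasurable: "cell \<in> lmeasurable"
  by (rule bounded_set_imp_lmeasurable[OF bounded_cell cell_lebesgue])

lemma emeasure_block:
  assumes "r \<le> s"
  shows "emeasure lebesgue (block r s) = ennreal ((s - r) ^ CARD('n)) * emeasure lebesgue cell"
proof (cases "r = s")
  case True
  then have "block r s = {}"
    by (auto simp: block_def)
  then show ?thesis using True by simp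
next
  case False
  then have l: "s - r > 0" using assms by simp
  \<comment> \<open>The translation part for which the homothety with factor s - r sends the corner
    p of the cell to the corner of the block.\<close>
  define d where "d = p + comb (\<chi> i. r) - (s - r) *\<^sub>R p"
  have c: "coord ((s - r) *\<^sub>R x + d) $ i = r + (s - r) * coord x $ i" for x i
  proof -
    have "(s - r) *\<^sub>R x + d - p = comb (\<chi> i. r) + (s - r) *\<^sub>R (x - p)"
      by (simp add: d_def algebra_simps)
    then show ?thesis
      by (simp add: coord_def linear_add[OF linear_lin_coord] linear_scale[OF linear_lin_coord])
  qed
  have "block r s = (\<lambda>x. (s - r) *\<^sub>R x + d) ` cell"
  proof (intro equalityI subsetI)
    fix x assume x: "x \<in> block r s"
    define y where "y = (1 / (s - r)) *\<^sub>R (x - d)"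
    have xy: "x = (s - r) *\<^sub>R y + d"
      using l by (simp add: y_def)
    have "y \<in> cell"
      using x l unfolding xy cell_eq_block block_def mem_Collect_eq c
      by (simp add: zero_le_mult_iff) (smt (verit) mult_less_cancel_left2)
    then show "x \<in> (\<lambda>x. (s - r) *\<^sub>R x + d) ` cell"
      using xy by blast
  next
    fix x assume "x \<in> (\<lambda>x. (s - r) *\<^sub>R x + d) ` cell"
    then show "x \<in> block r s"
      using l by (auto simp: cell_eq_block block_def c) (smt (verit) mult_less_cancel_left2)
  qed
  then show ?thesis
    using l by (simp add: emeasure_lebesgue_affine ennreal_power)
qed

text \<open>The cell contains the preimage of the open unit cube under \<open>coord\<close>, a
  non-empty open set.\<close>

lemma cell_measure_pos: "measure lebesgue cell > 0"
proof -
  let ?U = "coord -` box 0 (\<chi> i. 1)"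
  have "open ?U"
    by (intro open_vimage open_box continuous_on_coord)
  moreover have "p + comb (\<chi> i. 1/2) \<in> ?U"
    by (simp add: coord_comb mem_box_cart)
  ultimately have "\<not> negligible ?U"
    using open_not_negligible by blast
  moreover have "?U \<subseteq> cell"
    by (auto simp: cell_eq_block block_def mem_box_cart less_imp_le)
  ultimately have "\<not> negligible cell"
    using negligible_subset by blast
  then show ?thesis
    using cell_lmeasurable negligible_iff_measure zero_less_measure_iff by blast
qed

lemma emeasure_cell: "emeasure lebesgue cell = ennreal (measure lebesgue cell)"
  using cell_lmeasurable by (simp add: emeasure_eq_measure2)

lemma periodic_lat:
  assumes "periodic b f"
  shows "f (x + lat m) = f x"
proof -
  have "f (x + (\<Sum>i\<in>S. of_int (m i) *\<^sub>R b i)) = f x" if "finite S" for S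
    using that
  proof induction
    case (insert j S)
    have "f (x + (\<Sum>i\<in>insert j S. of_int (m i) *\<^sub>R b i))
        = f ((x + (\<Sum>i\<in>S. of_int (m i) *\<^sub>R b i)) + of_int (m j) *\<^sub>R b j)"
      using insert by (simp add: algebra_simps)
    then show ?case
      using periodic_int_multiple[OF assms] insert by simp
  qed simp
  then show ?thesis by (simp add: lat_def)
qed

text \<open>Translation invariance moves each integral over the cell to the tile with label m, and
  the tiles are disjoint. It is used in two ways: to reassemble a block from its cells, and to count
  the cells that meet a given set.\<close>

lemma nn_integral_tiles:
  assumes g [measurable]: "g \<in> borel_measurable lebesgue" and "finite I"
  shows "(\<Sum>m\<in>I. \<integral>\<^sup>+x. g (x + lat m) * indicator cell x \<partial>lebesgue)
    = (\<integral>\<^sup>+x. g x * indicator {x. idx x \<in> I} x \<partial>lebesgue)"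
proof -
  have [measurable]: "{x. idx x = m} \<in> sets lebesgue" for m
    by (intro borel_in_lebesgue idx_sets_borel)
  have "(\<integral>\<^sup>+x. g (x + lat m) * indicator cell x \<partial>lebesgue)
      = (\<integral>\<^sup>+x. g x * indicator {x. idx x = m} x \<partial>lebesgue)" for m
  proof -
    have "indicator cell x = (indicator {x. idx x = m} (x + lat m) :: ennreal)" for x
      by (auto simp: cell_iff_idx idx_add_lat indicator_def fun_eq_iff)
    then show ?thesis
      using nn_integral_lebesgue_translate[of "\<lambda>x. g x * indicator {x. idx x = m} x" "lat m"] by simp
  qed
  then have "(\<Sum>m\<in>I. \<integral>\<^sup>+x. g (x + lat m) * indicator cell x \<partial>lebesgue)
      = (\<integral>\<^sup>+x. (\<Sum>m\<in>I. g x * indicator {x. idx x = m} x) \<partial>lebesgue)"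
    by (simp add: nn_integral_sum)
  also have "\<dots> = (\<integral>\<^sup>+x. g x * indicator {x. idx x \<in> I} x \<partial>lebesgue)"
    using assms(2)
    by (intro nn_integral_cong) (auto simp: indicator_def if_distrib sum.delta cong: if_cong)
  finally show ?thesis .
qed

definition grid :: "nat \<Rightarrow> ('n \<Rightarrow> int) set" where
  "grid N = {m. \<forall>i. 0 \<le> m i \<and> m i < int N}"

lemma grid_PiE: "grid N = PiE UNIV (\<lambda>_. {0..<int N})"
  by (auto simp: grid_def PiE_def)

lemma finite_grid: "finite (grid N)"
  unfolding grid_PiE by (intro finite_PiE) auto

lemma card_grid: "card (grid N) = N ^ CARD('n)"
  unfolding grid_PiE by (subst card_PiE) auto

lemma idx_grid: "{x. idx x \<in> grid N} = block 0 (real N)"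
  by (auto simp: grid_def block_def idx_def floor_less_iff)

lemma finite_int_functions: "finite {m :: 'n \<Rightarrow> int. \<forall>i. \<bar>of_int (m i)\<bar> \<le> (B::real)}"
proof -
  have "-\<lceil>B\<rceil> \<le> k \<and> k \<le> \<lceil>B\<rceil>" if "\<bar>of_int k\<bar> \<le> B" for k :: int
    using that by linarith
  then have "{m :: 'n \<Rightarrow> int. \<forall>i. \<bar>of_int (m i)\<bar> \<le> B} \<subseteq> PiE UNIV (\<lambda>_. {-\<lceil>B\<rceil>..\<lceil>B\<rceil>})"
    by (auto simp: PiE_def)
  then show ?thesis
    by (rule finite_subset) (intro finite_PiE, auto)
qed

end

text \<open>K is chosen before T: both transitions are translates or reflections of one fixed step
  of width one, so the slope does not grow with the length of the plateau.\<close>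

lemma smooth_plateau_exists:
  obtains K :: real where "\<And>T. \<exists>g g'. smooth g \<and> (\<forall>t. 0 \<le> g t \<and> g t \<le> 1) \<and>
    (\<forall>t. t \<le> 1 \<or> t \<ge> T - 1 \<longrightarrow> g t = 0) \<and> (\<forall>t. 2 \<le> t \<and> t \<le> T - 2 \<longrightarrow> g t = 1) \<and>
    (\<forall>t. (g has_real_derivative g' t) (at t)) \<and> (\<forall>t. \<bar>g' t\<bar> \<le> K)"
proof -
  obtain s s' K where s: "smooth s" "\<And>t. 0 \<le> s t" "\<And>t. s t \<le> 1"
    "\<And>t. t \<le> 0 \<Longrightarrow> s t = 0" "\<And>t. t \<ge> 1 \<Longrightarrow> s t = 1"
    "\<And>t. (s has_real_derivative s' t) (at t)" "\<And>t. \<bar>s' t\<bar> \<le> K"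
    using smooth_step_exists by blast
  show ?thesis
  proof (rule that[of "K + K"], intro exI conjI allI impI)
    fix T :: real
    let ?g = "\<lambda>t. s (t - 1) * s (T - 1 - t)"
    let ?g' = "\<lambda>t. s' (t - 1) * s (T - 1 - t) - s (t - 1) * s' (T - 1 - t)"
    have "C_k k (\<lambda>t. s (t + (-1)))" "C_k k (\<lambda>t. s (- t + (T - 1)))" for k
      using s(1) C_k_affine_compose[OF bounded_linear_ident] C_k_affine_compose[OF bounded_linear_minus[OF bounded_linear_ident]]
      unfolding smooth_def by blast+
    then show "smooth ?g"
      unfolding smooth_def by (auto intro!: C_k_mult simp: algebra_simps)
    show "(?g has_real_derivative ?g' t) (at t)" for t
    proof -
      have "((\<lambda>t. s (t - 1)) has_real_derivative s' (t - 1) * 1) (at t)"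
        by (rule DERIV_chain2[OF s(6)]) (auto intro!: derivative_eq_intros)
      moreover have "((\<lambda>t. s (T - 1 - t)) has_real_derivative s' (T - 1 - t) * (- 1)) (at t)"
        by (rule DERIV_chain2[OF s(6)]) (auto intro!: derivative_eq_intros)
      ultimately show ?thesis
        by (rule DERIV_cong[OF DERIV_mult]) simp
    qed
    have le: "\<bar>s' u * s v\<bar> \<le> K" for u v
      using mult_mono[OF s(7)[of u] s(3)[of v]] s(2)[of v] s(7)[of u] by (simp add: abs_mult)
    show "\<bar>?g' t\<bar> \<le> K + K" for t
      using le[of "t - 1" "T - 1 - t"] le[of "T - 1 - t" "t - 1"] by (simp add: mult.commute)
    show "0 \<le> ?g t" "?g t \<le> 1" for t
      using s(2,3) by (auto intro: mult_le_one)
    show "?g t = 0" if "t \<le> 1 \<or> t \<ge> T - 1" for t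
      using that s(4)[of "t - 1"] s(4)[of "T - 1 - t"] by auto
    show "?g t = 1" if "2 \<le> t \<and> t \<le> T - 2" for t
      using that s(5)[of "t - 1"] s(5)[of "T - 1 - t"] by auto
  qed
qed

context lattice_cell
begin

section \<open>Counting the cells that meet an affine image of a block\<close>

lemma finite_idx_image:
  assumes "bounded S"
  shows "finite (idx ` S)"
proof -
  obtain K where K: "\<And>x i. \<bar>lin_coord x $ i\<bar> \<le> K * norm x" "K > 0"
    using lin_coord_bound by blast
  obtain R where R: "\<And>x. x \<in> S \<Longrightarrow> norm x \<le> R"
    using assms by (auto simp: bounded_iff)
  have "\<bar>of_int (idx x i)\<bar> \<le> K * (R + norm p) + 1" if "x \<in> S" for x i
  proof -
    have "\<bar>coord x $ i\<bar> \<le> K * norm (x - p)"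
      using K by (simp add: coord_def)
    also have "\<dots> \<le> K * (R + norm p)"
      using K(2) R[OF that] norm_triangle_ineq4[of x p] by (intro mult_left_mono) auto
    finally show ?thesis
      unfolding idx_def by linarith
  qed
  then have "idx ` S \<subseteq> {m. \<forall>i. \<bar>of_int (m i)\<bar> \<le> K * (R + norm p) + 1}"
    by auto
  then show ?thesis
    using finite_int_functions finite_subset by blast
qed

text \<open>The cells that meet the image of the block all lie in the image of a block enlarged by a
  fixed margin k on each side. The map preserves volume, so the number of these disjoint cells is at
  most the ratio of the enlarged volume to that of one cell.\<close>

lemma card_cells_meeting_affine_image:
  fixes A :: "real^'n^'n"
  assumes d: "\<bar>det A\<bar> = 1"
  shows "\<exists>k::nat. \<forall>N::nat. finite (idx ` (\<lambda>x. c + A *v x) ` block 0 (real N)) \<and>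
    card (idx ` (\<lambda>x. c + A *v x) ` block 0 (real N)) \<le> (N + 2 * k) ^ CARD('n)"
proof -
  obtain B where inv: "A ** B = mat 1" "B ** A = mat 1"
    using abs_det_one_inverse[OF d] by blast
  obtain K where K: "\<And>x i. \<bar>lin_coord x $ i\<bar> \<le> K * norm x" "K > 0"
    using lin_coord_bound by blast
  obtain L where L: "\<And>x. norm (B *v x) \<le> L * norm x" "L > 0"
    using linear_bounded_pos[OF matrix_vector_mul_linear] by blast
  obtain R where R: "\<And>x. x \<in> cell \<Longrightarrow> norm x \<le> R"
    using bounded_cell by (auto simp: bounded_iff)
  \<comment> \<open>R + R bounds the distance of two points in one cell, L the stretching by the
    inverse matrix B, and K that by lattice coordinates. Preimages of points sharing a cell thus
    differ by less than k in each coordinate.\<close>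
  define k where "k = nat \<lceil>K * (L * (R + R))\<rceil> + 1"
  let ?h = "\<lambda>x. c + A *v x"
  have sub: "{x. idx x \<in> idx ` ?h ` block 0 (real N)} \<subseteq> ?h ` block (- real k) (real N + real k)" for N
  proof
    fix x assume "x \<in> {x. idx x \<in> idx ` ?h ` block 0 (real N)}"
    then obtain y where y: "y \<in> block 0 (real N)" "idx x = idx (?h y)"
      by auto
    \<comment> \<open>Points with the same label are brought into the cell by the same lattice
      vector, so their distance is bounded by that within the cell.\<close>
    define m where "m = (\<lambda>i. - idx x i)"
    have "x + lat m \<in> cell" "?h y + lat m \<in> cell"
      using reduce_in_cell[of x] reduce_in_cell[of "?h y"] y by (auto simp: m_def)
    then have "norm (x - ?h y) \<le> R + R"
      using R[of "x + lat m"] R[of "?h y + lat m"] norm_triangle_ineq4[of "x + lat m" "?h y + lat m"]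
      by simp
    define z where "z = B *v (x - c)"
    have zx: "x = ?h z"
      by (simp add: z_def matrix_vector_mul_assoc inv)
    have "z - y = B *v (x - ?h y)"
      by (simp add: z_def matrix_vector_mult_diff_distrib matrix_vector_mul_assoc inv
          matrix_vector_right_distrib)
    then have "\<bar>lin_coord (z - y) $ i\<bar> \<le> K * (L * (R + R))" for i
    proof -
      have "\<bar>lin_coord (z - y) $ i\<bar> \<le> K * norm (B *v (x - ?h y))"
        using K(1) \<open>z - y = _\<close> by metis
      also have "\<dots> \<le> K * (L * norm (x - ?h y))"
        using L K by (intro mult_left_mono) auto
      also have "\<dots> \<le> K * (L * (R + R))"
        using L K \<open>norm (x - ?h y) \<le> R + R\<close> by (intro mult_left_mono) auto
      finally show ?thesis .
    qed
    moreover have "K * (L * (R + R)) < real k"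
      unfolding k_def by linarith
    ultimately have "\<bar>coord z $ i - coord y $ i\<bar> < real k" for i
      using coord_diff[of z y] by (metis le_less_trans vector_minus_component)
    then have "z \<in> block (- real k) (real N + real k)"
      using y(1) unfolding block_def by (auto simp: abs_less_iff) (smt (verit))+
    then show "x \<in> ?h ` block (- real k) (real N + real k)"
      using zx by blast
  qed
  have "card (idx ` ?h ` block 0 (real N)) \<le> (N + 2 * k) ^ CARD('n)"
    if fin: "finite (idx ` ?h ` block 0 (real N))" for N
  proof -
    let ?I = "idx ` ?h ` block 0 (real N)"
    have meas: "{x. idx x \<in> ?I} \<in> sets lebesgue"
    proof -
      have "{x. idx x \<in> ?I} = (\<Union>m\<in>?I. {x. idx x = m})"
        by auto
      also have "\<dots> \<in> sets lebesgue"
        using fin by (intro sets.finite_UN borel_in_lebesgue idx_sets_borel)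
      finally show ?thesis .
    qed
    \<comment> \<open>Tiling applied to the constant 1 turns the number of labels into a
      volume.\<close>
    have "of_nat (card ?I) * emeasure lebesgue cell = emeasure lebesgue {x. idx x \<in> ?I}"
      using nn_integral_tiles[OF measurable_const[of 1] fin] meas
      by simp
    also have "\<dots> \<le> emeasure lebesgue (?h ` block (- real k) (real N + real k))"
      by (intro emeasure_mono sub matrix_vector_image_lebesgue borel_in_lebesgue block_sets_borel)
    also have "\<dots> = ennreal ((real N + real k - (- real k)) ^ CARD('n)) * emeasure lebesgue cell"
      by (subst emeasure_affine_image[OF borel_in_lebesgue[OF block_sets_borel] d])
        (simp add: emeasure_block)
    finally have "ennreal (real (card ?I)) * emeasure lebesgue cell
        \<le> ennreal ((real N + 2 * real k) ^ CARD('n)) * emeasure lebesgue cell"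
      by (simp add: ennreal_of_nat_eq_real_of_nat algebra_simps)
    then have "real (card ?I) * measure lebesgue cell \<le> (real N + 2 * real k) ^ CARD('n) * measure lebesgue cell"
      by (simp add: emeasure_cell ennreal_mult'[symmetric])
    then have "real (card ?I) \<le> real ((N + 2 * k) ^ CARD('n))"
      using cell_measure_pos by simp
    then show ?thesis
      by (simp only: of_nat_le_iff)
  qed
  moreover have "finite (idx ` ?h ` block 0 (real N))" for N
  proof -
    have "bounded (?h ` block 0 (real N))"
      using bounded_translation[OF bounded_linear_image[OF bounded_block matrix_vector_mul_bounded_linear]]
      by (simp add: image_image)
    then show ?thesis by (rule finite_idx_image)
  qed
  ultimately show ?thesis by blast
qed

text \<open>A change of variables moves the integral to the image of the block, which is then
  enlarged to full cells; by periodicity each of them contributes the same integral. The margin k is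
  uniform in N and in f.\<close>

lemma nn_integral_affine_block_le:
  fixes A :: "real^'n^'n"
  assumes d: "\<bar>det A\<bar> = 1"
  obtains k :: nat where
    "\<And>N f. f \<in> borel_measurable lebesgue \<Longrightarrow> periodic b f \<Longrightarrow>
      (\<integral>\<^sup>+x. f (c + A *v x) * indicator (block 0 (real N)) x \<partial>lebesgue)
      \<le> of_nat ((N + 2 * k) ^ CARD('n)) * (\<integral>\<^sup>+x. f x * indicator cell x \<partial>lebesgue)"
proof -
  let ?h = "\<lambda>x. c + A *v x"
  obtain k where k: "\<And>N::nat. finite (idx ` ?h ` block 0 (real N)) \<and>
    card (idx ` ?h ` block 0 (real N)) \<le> (N + 2 * k) ^ CARD('n)"
    using card_cells_meeting_affine_image[OF d] by blast
  show ?thesis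
  proof (rule that[of k])
    fix N and f :: "real^'n \<Rightarrow> ennreal"
    assume f [measurable]: "f \<in> borel_measurable lebesgue" and per: "periodic b f"
    let ?I = "idx ` ?h ` block 0 (real N)"
    have [measurable]: "{x. idx x \<in> ?I} \<in> sets lebesgue"
    proof -
      have "{x. idx x \<in> ?I} = (\<Union>m\<in>?I. {x. idx x = m})"
        by auto
      also have "\<dots> \<in> sets lebesgue"
        using k[of N] by (intro sets.finite_UN borel_in_lebesgue idx_sets_borel) blast
      finally show ?thesis .
    qed
    have "(\<integral>\<^sup>+x. f (?h x) * indicator (block 0 (real N)) x \<partial>lebesgue)
        \<le> (\<integral>\<^sup>+x. f (?h x) * indicator {x. idx x \<in> ?I} (?h x) \<partial>lebesgue)"
      by (intro nn_integral_mono mult_left_mono) (auto simp: indicator_def)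
    also have "\<dots> = (\<integral>\<^sup>+x. f x * indicator {x. idx x \<in> ?I} x \<partial>lebesgue)"
      by (rule nn_integral_lebesgue_affine[OF d]) measurable
    also have "\<dots> = of_nat (card ?I) * (\<integral>\<^sup>+x. f x * indicator cell x \<partial>lebesgue)"
      using nn_integral_tiles[OF f, of ?I] k[of N] by (simp add: periodic_lat[OF per])
    also have "\<dots> \<le> of_nat ((N + 2 * k) ^ CARD('n)) * (\<integral>\<^sup>+x. f x * indicator cell x \<partial>lebesgue)"
      using k[of N] by (intro mult_right_mono) (auto simp del: of_nat_power)
    finally show "(\<integral>\<^sup>+x. f (?h x) * indicator (block 0 (real N)) x \<partial>lebesgue)
      \<le> of_nat ((N + 2 * k) ^ CARD('n)) * (\<integral>\<^sup>+x. f x * indicator cell x \<partial>lebesgue)" .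
  qed
qed

section \<open>Periodization of functions with bounded support\<close>

definition periodize :: "(real^'n \<Rightarrow> 'c::real_normed_vector) \<Rightarrow> real^'n \<Rightarrow> 'c" where
  "periodize f x = (\<Sum>m | f (x + lat m) \<noteq> 0. f (x + lat m))"

lemma periodize_eq_sum:
  assumes "finite J" "\<And>m. f (x + lat m) \<noteq> 0 \<Longrightarrow> m \<in> J"
  shows "periodize f x = (\<Sum>m\<in>J. f (x + lat m))"
  unfolding periodize_def using assms by (intro sum.mono_neutral_left) auto

lemma lat_add: "lat (\<lambda>j. m j + k j) = lat m + lat k"
  by (simp add: lat_def algebra_simps sum.distrib)

text \<open>Adding \<open>b i\<close> permutes the lattice and so only relabels the terms. The index
  set of \<open>periodize\<close> is restricted to nonzero terms because a sum over all of the
  infinite lattice would be 0 by convention; the relabelling respects this restriction.\<close>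

lemma periodic_periodize: "periodic b (periodize f)"
  unfolding periodic_def
proof (intro allI)
  fix x i
  define e :: "'n \<Rightarrow> int" where "e = (\<lambda>j. if j = i then 1 else 0)"
  have e: "lat e = b i"
    by (simp add: lat_def e_def if_distrib[of of_int] if_distrib[of "\<lambda>r. r *\<^sub>R _"] cong: if_cong)
  have eq: "x + b i + lat m = x + lat (\<lambda>j. m j + e j)" for m
    by (simp add: lat_add e)
  have "bij_betw (\<lambda>m j. m j + e j) {m. f (x + b i + lat m) \<noteq> 0} {m. f (x + lat m) \<noteq> 0}"
    unfolding eq by (rule bij_betwI[where g = "\<lambda>m j. m j - e j"]) auto
  then show "periodize f (x + b i) = periodize f x"
    using sum.reindex_bij_betw[of "\<lambda>m j. m j + e j" _ _ "\<lambda>m. f (x + lat m)"]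
    by (simp add: periodize_def eq)
qed

text \<open>The same J serves every y in the ball. Near x the periodization is therefore a fixed
  finite sum, which can be differentiated term by term.\<close>

lemma local_finite_support:
  assumes "\<And>x. norm x > R \<Longrightarrow> f x = 0"
  obtains J where "finite J" "\<And>y m. y \<in> ball x 1 \<Longrightarrow> f (y + lat m) \<noteq> 0 \<Longrightarrow> m \<in> J"
proof -
  obtain K where K: "\<And>x i. \<bar>lin_coord x $ i\<bar> \<le> K * norm x" "K > 0"
    using lin_coord_bound by blast
  have "\<bar>of_int (m i)\<bar> \<le> K * (R + norm x + 1)" if "y \<in> ball x 1" "f (y + lat m) \<noteq> 0" for y m i
  proof -
    have "norm (y + lat m) \<le> R"
      using assms that(2) by force
    moreover have "norm y \<le> norm x + 1"
      using that(1) norm_triangle_ineq2[of y x] by (simp add: dist_norm norm_minus_commute)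
    ultimately have "norm (lat m) \<le> R + norm x + 1"
      using norm_triangle_ineq4[of "y + lat m" y] by simp
    then have "K * norm (lat m) \<le> K * (R + norm x + 1)"
      using K(2) by (intro mult_left_mono) auto
    then show ?thesis
      using K(1)[of "lat m" i] by (simp add: lat_comb)
  qed
  then show ?thesis
    using finite_int_functions[of "K * (R + norm x + 1)"]
    by (intro that[of "{m. \<forall>i. \<bar>of_int (m i)\<bar> \<le> K * (R + norm x + 1)}"]) auto
qed

text \<open>The exterior of the closed ball is open, so derivatives vanish there as well: the radius
  R survives repeated differentiation.\<close>

lemma has_derivative_zero_outside:
  assumes "\<And>x. norm x > R \<Longrightarrow> f x = 0" "norm x > R" "(f has_derivative f') (at x)"
  shows "f' = (\<lambda>_. 0)"
proof -
  have "open {x. norm x > R}"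
    by (intro open_Collect_less continuous_intros)
  then have "((\<lambda>x. 0) has_derivative f') (at x)"
    using has_derivative_transform_within_open[OF assms(3), of "{x. norm x > R}" "\<lambda>_. 0"] assms by auto
  then show ?thesis
    using has_derivative_unique has_derivative_const by blast
qed

lemma periodize_has_derivative:
  assumes supp: "\<And>x. norm x > R \<Longrightarrow> f x = 0" and der: "\<And>x. (f has_derivative f' x) (at x)"
  shows "(periodize f has_derivative (\<lambda>u. periodize (\<lambda>z. f' z u) x)) (at x)"
proof -
  obtain J where J: "finite J" "\<And>y m. y \<in> ball x 1 \<Longrightarrow> f (y + lat m) \<noteq> 0 \<Longrightarrow> m \<in> J"
    using local_finite_support[of R f, OF supp] by blast
  have supp': "f' z u = 0" if "norm z > R" for z u
    using has_derivative_zero_outside[OF supp that der] by simp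
  have shifted: "((\<lambda>y. f (y + lat m)) has_derivative f' (x + lat m)) (at x)" for m
  proof -
    have "((\<lambda>y. y + lat m) has_derivative (\<lambda>u. u)) (at x)"
      by (auto intro!: derivative_eq_intros)
    from has_derivative_compose[OF this der] show ?thesis
      by simp
  qed
  \<comment> \<open>A translate with label outside J vanishes on the whole ball, hence so does its
    derivative at x; J also captures the periodization of the derivative.\<close>
  have J': "m \<in> J \<or> f' (x + lat m) u = 0" for m u
  proof (cases "m \<in> J")
    case False
    have "((\<lambda>y. 0) has_derivative f' (x + lat m)) (at x)"
      by (rule has_derivative_transform_within_open[OF shifted open_ball[of x 1]]) (use False J(2) in auto)
    then show ?thesis
      using has_derivative_unique has_derivative_const by metis
  qed auto
  have "((\<lambda>y. \<Sum>m\<in>J. f (y + lat m)) has_derivative (\<lambda>u. \<Sum>m\<in>J. f' (x + lat m) u)) (at x)"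
    by (intro has_derivative_sum shifted)
  moreover have "(\<Sum>m\<in>J. f' (x + lat m) u) = periodize (\<lambda>z. f' z u) x" for u
    by (rule periodize_eq_sum[symmetric, OF J(1)]) (use J' in blast)
  moreover have "(\<Sum>m\<in>J. f (y + lat m)) = periodize f y" if "y \<in> ball x 1" for y
    using that J by (intro periodize_eq_sum[symmetric] J) auto
  ultimately show ?thesis
    by (auto intro: has_derivative_transform_within_open[OF _ open_ball[of x 1]])
qed

lemma smooth_periodize:
  assumes "smooth f" "\<And>x. norm x > R \<Longrightarrow> f x = 0"
  shows "smooth (periodize f)"
\<comment> \<open>The invariant keeps one radius R throughout, so that every derivative is again the
  periodization of a smooth function supported in the same ball.\<close>
proof (rule smooth_coinduct[where P = "\<lambda>g. \<exists>f. g = periodize f \<and> smooth f \<and> (\<forall>x. norm x > R \<longrightarrow> f x = 0)"])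
  show "\<exists>f'. periodize f = periodize f' \<and> smooth f' \<and> (\<forall>x. norm x > R \<longrightarrow> f' x = 0)"
    using assms by blast
next
  fix g :: "real^'n \<Rightarrow> 'a"
  assume "\<exists>f. g = periodize f \<and> smooth f \<and> (\<forall>x. norm x > R \<longrightarrow> f x = 0)"
  then obtain f where f: "g = periodize f" "smooth f" "\<And>x. norm x > R \<Longrightarrow> f x = 0"
    by blast
  let ?D = "\<lambda>x. frechet_derivative f (at x)"
  have "(g has_derivative (\<lambda>u. periodize (\<lambda>z. ?D z u) x)) (at x)" for x
    unfolding f(1) by (rule periodize_has_derivative[of R, OF f(3) smooth_has_derivative[OF f(2)]])
  moreover have "smooth (\<lambda>z. ?D z u)" "\<forall>z. norm z > R \<longrightarrow> ?D z u = 0" for u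
    using smooth_frechet_derivative[OF f(2)] has_derivative_zero_outside[OF f(3) _ smooth_has_derivative[OF f(2)]]
    by auto
  ultimately show "\<exists>f'. (\<forall>x. (g has_derivative f' x) (at x)) \<and>
      (\<forall>u. \<exists>f. (\<lambda>x. f' x u) = periodize f \<and> smooth f \<and> (\<forall>x. norm x > R \<longrightarrow> f x = 0))"
    by (intro exI[of _ "\<lambda>x u. periodize (\<lambda>z. ?D z u) x"]) blast
qed

text \<open>A product of one-dimensional plateaus in lattice coordinates. The product rule gives n
  terms, each bounded by the slope K of a plateau times the bound K1 of a coordinate functional, as
  the other factors lie between 0 and 1. Nothing in this bound depends on T.\<close>

lemma cutoff_exists:
  obtains K :: real where "\<And>T. \<exists>w w'. smooth w \<and> (\<forall>x. 0 \<le> w x \<and> w x \<le> 1) \<and>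
    (\<forall>x. x \<notin> block 1 (T - 1) \<longrightarrow> w x = 0) \<and> (\<forall>x\<in>block 2 (T - 2). w x = 1) \<and>
    (\<forall>x. (w has_derivative w' x) (at x)) \<and> (\<forall>x u. \<bar>w' x u\<bar> \<le> K * norm u)"
proof -
  obtain K1 where K1: "\<And>x i. \<bar>lin_coord x $ i\<bar> \<le> K1 * norm x" "K1 > 0"
    using lin_coord_bound by blast
  obtain K :: real where K: "\<And>T. \<exists>g g'. smooth g \<and> (\<forall>t. 0 \<le> g t \<and> g t \<le> 1) \<and>
    (\<forall>t. t \<le> 1 \<or> t \<ge> T - 1 \<longrightarrow> g t = 0) \<and> (\<forall>t. 2 \<le> t \<and> t \<le> T - 2 \<longrightarrow> g t = 1) \<and>
    (\<forall>t. (g has_real_derivative g' t) (at t)) \<and> (\<forall>t. \<bar>g' t\<bar> \<le> K)"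
    using smooth_plateau_exists by blast
  show ?thesis
  proof (rule that[of "real CARD('n) * (K * K1)"])
    fix T :: real
    obtain g g' where g: "smooth g" "\<And>t. 0 \<le> g t" "\<And>t. g t \<le> 1"
      "\<And>t. t \<le> 1 \<or> t \<ge> T - 1 \<Longrightarrow> g t = 0" "\<And>t. 2 \<le> t \<and> t \<le> T - 2 \<Longrightarrow> g t = 1"
      "\<And>t. (g has_real_derivative g' t) (at t)" "\<And>t. \<bar>g' t\<bar> \<le> K"
      using K[of T] by blast
    define w where "w x = (\<Prod>i\<in>UNIV. g (coord x $ i))" for x
    define w' where "w' x u = (\<Sum>i\<in>UNIV. (g' (coord x $ i) * lin_coord u $ i) * (\<Prod>j\<in>UNIV - {i}. g (coord x $ j)))" for x u
    have bl: "bounded_linear (\<lambda>u. lin_coord u $ i)" for i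
      using linear_lin_coord by (intro bounded_linear_compose[OF bounded_linear_vec_nth])
        (simp add: linear_conv_bounded_linear)
    have co: "coord x $ i = lin_coord x $ i + - (lin_coord p $ i)" for x i
      by (simp add: coord_def linear_diff[OF linear_lin_coord])
    have "smooth w"
      unfolding smooth_def w_def co using g(1) unfolding smooth_def
      by (intro allI C_k_prod C_k_affine_compose[OF bl]) blast
    moreover have "0 \<le> w x" "w x \<le> 1" for x
      using g(2,3) by (auto simp: w_def intro: prod_nonneg prod_le_1)
    moreover have "w x = 0" if x: "x \<notin> block 1 (T - 1)" for x
    proof -
      obtain i where "\<not> (1 \<le> coord x $ i \<and> coord x $ i < T - 1)"
        using x by (auto simp: block_def)
      then have "coord x $ i \<le> 1 \<or> coord x $ i \<ge> T - 1"
        by linarith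
      then show ?thesis
        using g(4) by (auto simp: w_def)
    qed
    moreover have "w x = 1" if "x \<in> block 2 (T - 2)" for x
      using that g(5) by (auto simp: w_def block_def less_imp_le intro!: prod.neutral)
    moreover have "(w has_derivative w' x) (at x)" for x
    proof -
      have "((\<lambda>x. coord x $ i) has_derivative (\<lambda>u. lin_coord u $ i)) (at x)" for i
        unfolding co by (rule derivative_eq_intros bounded_linear_imp_has_derivative[OF bl] refl)+ simp
      moreover have "(g has_derivative (\<lambda>u. g' t * u)) (at t)" for t
        using g(6)[of t] by (simp add: has_field_derivative_def)
      ultimately have "((\<lambda>x. g (coord x $ i)) has_derivative (\<lambda>u. g' (coord x $ i) * lin_coord u $ i)) (at x)" for i
        by (rule has_derivative_compose)
      then show ?thesis
        unfolding w_def w'_def by (intro has_derivative_prod)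
    qed
    moreover have "\<bar>w' x u\<bar> \<le> real CARD('n) * (K * K1) * norm u" for x u
    proof -
      have "\<bar>(g' (coord x $ i) * lin_coord u $ i) * (\<Prod>j\<in>UNIV - {i}. g (coord x $ j))\<bar> \<le> K * (K1 * norm u)" for i
      proof -
        have "\<bar>g' (coord x $ i) * lin_coord u $ i\<bar> \<le> K * (K1 * norm u)"
          unfolding abs_mult using g(7)[of "coord x $ i"] K1 by (intro mult_mono) auto
        moreover have "0 \<le> (\<Prod>j\<in>UNIV - {i}. g (coord x $ j))" "(\<Prod>j\<in>UNIV - {i}. g (coord x $ j)) \<le> 1"
          using g(2,3) by (auto intro: prod_nonneg prod_le_1)
        ultimately show ?thesis
          unfolding abs_mult[of "_ * _"] by (smt (verit) mult_left_le abs_of_nonneg abs_ge_zero)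
      qed
      then have "\<bar>w' x u\<bar> \<le> (\<Sum>i\<in>(UNIV::'n set). K * (K1 * norm u))"
        unfolding w'_def by (intro sum_abs[THEN order_trans] sum_mono)
      then show ?thesis by (simp add: mult.assoc)
    qed
    ultimately show "\<exists>w w'. smooth w \<and> (\<forall>x. 0 \<le> w x \<and> w x \<le> 1) \<and>
    (\<forall>x. x \<notin> block 1 (T - 1) \<longrightarrow> w x = 0) \<and> (\<forall>x\<in>block 2 (T - 2). w x = 1) \<and>
    (\<forall>x. (w has_derivative w' x) (at x)) \<and> (\<forall>x u. \<bar>w' x u\<bar> \<le> real CARD('n) * (K * K1) * norm u)"
      by (intro exI[of _ w] exI[of _ w']) blast
  qed
qed

end

section \<open>Derivatives and square integrability\<close>

text \<open>Expanding F in the standard basis leaves T evaluated at fixed vectors, and evaluation at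
  a fixed vector is continuous in the operator norm.\<close>

lemma borel_measurable_blinfun_apply:
  fixes T :: "'a \<Rightarrow> ('b::euclidean_space \<Rightarrow>\<^sub>L 'c::euclidean_space)"
  assumes T: "T \<in> borel_measurable M" and F: "F \<in> borel_measurable M"
  shows "(\<lambda>y. blinfun_apply (T y) (F y)) \<in> borel_measurable M"
proof -
  have "(\<lambda>y. blinfun_apply (T y) i) \<in> borel_measurable M" for i
    by (rule measurable_compose[OF T borel_measurable_continuous_onI[OF
          linear_continuous_on[OF blinfun.bounded_linear_left]]])
  then have "(\<lambda>y. \<Sum>i\<in>Basis. (F y \<bullet> i) *\<^sub>R blinfun_apply (T y) i) \<in> borel_measurable M"
    using F by measurable
  moreover have "blinfun_apply (T y) (F y) = (\<Sum>i\<in>Basis. (F y \<bullet> i) *\<^sub>R blinfun_apply (T y) i)" for y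
    using blinfun.sum_right[of "T y" "\<lambda>i. (F y \<bullet> i) *\<^sub>R i" Basis]
    by (simp add: euclidean_representation blinfun.scaleR_right)
  ultimately show ?thesis by simp
qed

lemma square_integrable_diff:
  assumes F: "square_integrable S F" and G: "square_integrable S G"
  shows "square_integrable S (\<lambda>y. F y - G y)"
proof -
  have [measurable]: "F \<in> borel_measurable (lebesgue_on S)" "G \<in> borel_measurable (lebesgue_on S)"
    using F G by (auto simp: square_integrable_def)
  have "integrable (lebesgue_on S) (\<lambda>y. 2 * (norm (F y))\<^sup>2 + 2 * (norm (G y))\<^sup>2)"
    using F G by (auto simp: square_integrable_def)
  then have "integrable (lebesgue_on S) (\<lambda>y. (norm (F y - G y))\<^sup>2)"
  proof (rule Bochner_Integration.integrable_bound)
    have "(norm (F y - G y))\<^sup>2 \<le> 2 * (norm (F y))\<^sup>2 + 2 * (norm (G y))\<^sup>2" for y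
    proof -
      have "(norm (F y - G y))\<^sup>2 \<le> (norm (F y) + norm (G y))\<^sup>2"
        by (intro power_mono norm_triangle_ineq4) auto
      also have "\<dots> \<le> 2 * (norm (F y))\<^sup>2 + 2 * (norm (G y))\<^sup>2"
        using sum_squares_bound[of "norm (F y)" "norm (G y)"] by (simp add: power2_sum)
      finally show ?thesis .
    qed
    then show "AE y in lebesgue_on S. norm ((norm (F y - G y))\<^sup>2)
        \<le> norm (2 * (norm (F y))\<^sup>2 + 2 * (norm (G y))\<^sup>2)"
      by (intro AE_I2) (metis abs_ge_self abs_power2 order_trans real_norm_def)
  qed measurable
  then show ?thesis
    by (simp add: square_integrable_def)
qed

lemma square_integrable_add:
  assumes "square_integrable S F" and "square_integrable S G"
  shows "square_integrable S (\<lambda>y. F y + G y)"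
  using square_integrable_diff[OF assms(1) square_integrable_diff[OF _ assms(2)], of "\<lambda>_. 0"]
  by (simp add: square_integrable_def)

lemma has_derivative_jacobian:
  fixes f :: "real^'n \<Rightarrow> real^'m"
  assumes "smooth f"
  shows "(f has_derivative (\<lambda>u. jacobian f (at x) *v u)) (at x)"
  using assms smooth_has_derivative[OF assms, of x] jacobian_works differentiable_def by blast

lemma jacobian_eqI:
  fixes f :: "real^'n \<Rightarrow> real^'m"
  assumes "(f has_derivative (\<lambda>u. A *v u)) (at x)"
  shows "jacobian f (at x) = A"
  using frechet_derivative_at[OF assms] unfolding jacobian_def
  by (metis matrix_of_matrix_vector_mul)

lemma continuous_on_jacobian:
  fixes f :: "real^'n \<Rightarrow> real^'m"
  assumes "smooth f"
  shows "continuous_on UNIV (\<lambda>x. jacobian f (at x))"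
  unfolding jacobian_def matrix_def
  by (intro continuous_on_vec_lambda continuous_on_component
      smooth_imp_continuous_on[OF smooth_frechet_derivative[OF assms]])

text \<open>The norm on matrices is the Frobenius norm, whereas the hypothesis bounds the operator
  norm. Axis vectors bound each entry by K; the crude factor n^2 is harmless because only uniformity
  of the bound matters.\<close>

lemma norm_matrix_le:
  fixes A :: "real^'n^'n"
  assumes "\<And>u. norm (A *v u) \<le> K * norm u"
  shows "norm A \<le> real CARD('n) * (real CARD('n) * K)"
proof -
  have "\<bar>A $ i $ j\<bar> \<le> K" for i j
    using component_le_norm_cart[of "A *v axis j 1" i] assms[of "axis j 1"]
    by (simp add: matrix_vector_mult_basis column_def)
  then have row: "norm (A $ i) \<le> real CARD('n) * K" for i
    by (intro order_trans[OF norm_le_l1_cart sum_bounded_above])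
  have "norm A \<le> (\<Sum>i\<in>UNIV. norm (A $ i))"
    unfolding norm_vec_def[of A] by (rule L2_set_le_sum) simp
  also have "\<dots> \<le> real CARD('n) * (real CARD('n) * K)"
    by (rule sum_bounded_above[OF row])
  finally show ?thesis .
qed

text \<open>The half-open cell is not closed; compactness comes from its closure.\<close>

lemma (in lattice_cell) continuous_bounded_on_cell:
  fixes f :: "real^'n \<Rightarrow> 'c::real_normed_vector"
  assumes "continuous_on UNIV f"
  obtains R where "\<And>x. x \<in> cell \<Longrightarrow> norm (f x) \<le> R" "R > 0"
proof -
  have "compact (f ` closure cell)"
    using bounded_cell by (intro compact_continuous_image continuous_on_subset[OF assms]) auto
  then have "bounded (f ` cell)"
    by (rule bounded_subset[OF compact_imp_bounded]) (intro image_mono closure_subset)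
  then show ?thesis
    using that unfolding bounded_pos by blast
qed

lemma (in lattice_cell) square_integrable_continuous:
  fixes f :: "real^'n \<Rightarrow> 'c::euclidean_space"
  assumes "continuous_on UNIV f"
  shows "square_integrable cell f"
proof -
  have m: "f \<in> borel_measurable (lebesgue_on cell)"
    using assms cell_lebesgue continuous_imp_measurable_on_sets_lebesgue continuous_on_subset by blast
  obtain R where R: "\<And>x. x \<in> cell \<Longrightarrow> norm (f x) \<le> R"
    using continuous_bounded_on_cell[OF assms] by blast
  have "integrable (lebesgue_on cell) (\<lambda>y. (norm (f y))\<^sup>2)"
  proof (rule Bochner_Integration.integrable_bound[of _ "\<lambda>_. R\<^sup>2"])
    show "integrable (lebesgue_on cell) (\<lambda>_. R\<^sup>2)"
      by (intro finite_measure.integrable_const finite_measure_lebesgue_on cell_lmeasurable)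
    show "AE x in lebesgue_on cell. norm ((norm (f x))\<^sup>2) \<le> norm (R\<^sup>2)"
      using R by (intro AE_I2) (simp add: power_mono)
  qed (use m in measurable)
  then show ?thesis
    using m by (simp add: square_integrable_def)
qed

lemma (in lattice_cell) periodic_continuous_bounded:
  fixes f :: "real^'n \<Rightarrow> 'c::real_normed_vector"
  assumes "continuous_on UNIV f" "periodic b f"
  obtains R where "\<And>x. norm (f x) \<le> R" "R > 0"
proof -
  obtain R where R: "\<And>x. x \<in> cell \<Longrightarrow> norm (f x) \<le> R" "R > 0"
    using continuous_bounded_on_cell[OF assms(1)] by blast
  have "norm (f x) \<le> R" for x
    using R(1)[OF reduce_in_cell[of x]] by (simp add: periodic_lat[OF assms(2)])
  then show ?thesis
    using that R(2) by blast
qed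

lemma periodic_frechet_derivative:
  assumes per: "periodic b f" and der: "\<And>x. (f has_derivative f' x) (at x)"
  shows "periodic b f'"
  unfolding periodic_def
proof (intro allI)
  fix x i
  have "((\<lambda>y. y + b i) has_derivative (\<lambda>u. u)) (at x)"
    by (auto intro!: derivative_eq_intros)
  from has_derivative_compose[OF this der] have "(f has_derivative f' (x + b i)) (at x)"
    using per by (simp add: periodic_def)
  then show "f' (x + b i) = f' x"
    using der has_derivative_unique by blast
qed

text \<open>For a fixed direction the derivative is continuous and periodic, hence bounded;
  linearity along the axes makes the bound uniform in the direction. The added 1 makes the constant
  positive.\<close>

lemma (in lattice_cell) periodic_derivative_bounded:
  fixes f :: "real^'n \<Rightarrow> 'c::real_normed_vector"
  assumes f: "smooth f" "periodic b f"
  obtains R where "\<And>x u. norm (frechet_derivative f (at x) u) \<le> R * norm u" "R > 0"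
proof -
  let ?D = "\<lambda>x. frechet_derivative f (at x)"
  have per: "periodic b ?D"
    by (rule periodic_frechet_derivative[OF f(2) smooth_has_derivative[OF f(1)]])
  have "\<exists>R. \<forall>x. norm (?D x u) \<le> R" for u
    using periodic_continuous_bounded[OF smooth_imp_continuous_on[OF smooth_frechet_derivative[OF f(1), of u]]] per
    unfolding periodic_def by metis
  then obtain R where R: "\<And>u x. norm (?D x u) \<le> R u"
    by metis
  have "norm (?D x u) \<le> ((\<Sum>j\<in>UNIV. \<bar>R (axis j 1)\<bar>) + 1) * norm u" for x u
  proof -
    have lin: "linear (?D x)"
      using smooth_has_derivative[OF f(1)] has_derivative_linear by blast
    have "?D x u = ?D x (\<Sum>j\<in>UNIV. u $ j *\<^sub>R axis j 1)"
      using basis_expansion[of u] by (simp add: scalar_mult_eq_scaleR)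
    also have "\<dots> = (\<Sum>j\<in>UNIV. u $ j *\<^sub>R ?D x (axis j 1))"
      by (simp add: linear_sum[OF lin] linear_scale[OF lin])
    also have "norm \<dots> \<le> (\<Sum>j\<in>UNIV. \<bar>R (axis j 1)\<bar> * norm u)"
    proof (rule sum_norm_le)
      fix j
      have "\<bar>u $ j\<bar> * norm (?D x (axis j 1)) \<le> norm u * \<bar>R (axis j 1)\<bar>"
        using R[of x "axis j 1"] by (intro mult_mono component_le_norm_cart) auto
      then show "norm (u $ j *\<^sub>R ?D x (axis j 1)) \<le> \<bar>R (axis j 1)\<bar> * norm u"
        by (simp add: mult.commute)
    qed
    also have "\<dots> \<le> ((\<Sum>j\<in>UNIV. \<bar>R (axis j 1)\<bar>) + 1) * norm u"
      by (simp add: sum_distrib_right distrib_right)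
    finally show ?thesis .
  qed
  moreover have "(\<Sum>j\<in>(UNIV::'n set). \<bar>R (axis j 1)\<bar>) + 1 > 0"
    by (simp add: sum_nonneg add_nonneg_pos)
  ultimately show ?thesis
    using that by blast
qed

lemma (in lattice_cell) smooth_periodic_in_H1_per:
  assumes "smooth f" "periodic b f"
  shows "(f, \<lambda>y. jacobian f (at y)) \<in> H1_per p b"
  unfolding H1_per_def using assms
  by (auto intro!: square_integrable_continuous smooth_imp_continuous_on continuous_on_jacobian
      exI[of _ "\<lambda>_. f"])

section \<open>Elastic energy\<close>

lemma inner_matrix_mult:
  fixes A B H :: "real^'n^'n"
  shows "A \<bullet> (H ** B) = (transpose H ** A) \<bullet> B"
    and "A \<bullet> (B ** H) = (A ** transpose H) \<bullet> B"
proof -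
  have "A \<bullet> (H ** B) = (\<Sum>i\<in>UNIV. \<Sum>j\<in>UNIV. \<Sum>k\<in>UNIV. A $ i $ j * (H $ i $ k * B $ k $ j))"
    by (simp add: inner_vec_def matrix_matrix_mult_def sum_distrib_left)
  also have "\<dots> = (\<Sum>i\<in>UNIV. \<Sum>k\<in>UNIV. \<Sum>j\<in>UNIV. A $ i $ j * (H $ i $ k * B $ k $ j))"
    by (intro sum.cong refl sum.swap)
  also have "\<dots> = (\<Sum>k\<in>UNIV. \<Sum>i\<in>UNIV. \<Sum>j\<in>UNIV. A $ i $ j * (H $ i $ k * B $ k $ j))"
    by (rule sum.swap)
  also have "\<dots> = (\<Sum>k\<in>UNIV. \<Sum>j\<in>UNIV. \<Sum>i\<in>UNIV. A $ i $ j * (H $ i $ k * B $ k $ j))"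
    by (intro sum.cong refl sum.swap)
  also have "\<dots> = (transpose H ** A) \<bullet> B"
    by (simp add: inner_vec_def matrix_matrix_mult_def sum_distrib_left transpose_def mult_ac)
  finally show "A \<bullet> (H ** B) = (transpose H ** A) \<bullet> B" .
  have "A \<bullet> (B ** H) = (\<Sum>i\<in>UNIV. \<Sum>j\<in>UNIV. \<Sum>k\<in>UNIV. A $ i $ j * (B $ i $ k * H $ k $ j))"
    by (simp add: inner_vec_def matrix_matrix_mult_def sum_distrib_left)
  also have "\<dots> = (\<Sum>i\<in>UNIV. \<Sum>k\<in>UNIV. \<Sum>j\<in>UNIV. A $ i $ j * (B $ i $ k * H $ k $ j))"
    by (intro sum.cong refl sum.swap)
  also have "\<dots> = (A ** transpose H) \<bullet> B"
    by (simp add: inner_vec_def matrix_matrix_mult_def sum_distrib_left transpose_def mult_ac)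
  finally show "A \<bullet> (B ** H) = (A ** transpose H) \<bullet> B" .
qed

definition pull :: "real^'n^'n \<Rightarrow> real^'n^'n \<Rightarrow> real^'n^'n" where
  "pull H A = transpose H ** A ** H"

lemma inner_push:
  "A \<bullet> (H ** B ** transpose H) = pull H A \<bullet> B"
  unfolding pull_def inner_matrix_mult(2)[of A "H ** B"] inner_matrix_mult(1)[of _ H B]
  by (simp add: transpose_transpose matrix_mul_assoc)

lemma pull_add: "pull H (A + B) = pull H A + pull H B"
  by (simp add: pull_def matrix_matrix_mult_def vec_eq_iff sum.distrib distrib_left distrib_right)

lemma pull_scaleR: "pull H (r *\<^sub>R A) = r *\<^sub>R pull H A"
  by (simp add: pull_def matrix_matrix_mult_def vec_eq_iff sum_distrib_left sum_distrib_right mult_ac)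

lemma transpose_pull: "transpose (pull H A) = pull H (transpose A)"
  by (simp add: pull_def matrix_transpose_mul transpose_transpose matrix_mul_assoc)

lemma sym_part_pull: "sym_part (pull H A) = pull H (sym_part A)"
  by (simp add: sym_part_def transpose_pull pull_add pull_scaleR)

lemma pull_Sym: "A \<in> Sym \<Longrightarrow> pull H A \<in> Sym"
  by (simp add: Sym_def transpose_pull)

lemma sym_part_Sym: "sym_part A \<in> Sym"
  by (simp add: sym_part_def Sym_def transpose_def vec_eq_iff add.commute)

section \<open>Pointwise properties of the energy density\<close>

locale elastic_structure =
  fixes p :: "real^'n" and b :: "'n \<Rightarrow> real^'n" and C :: "real^'n \<Rightarrow> 'n elasticity_tensor"
  assumes elastic: "periodic_elastic_structure p b C"
begin

sublocale lattice_cell p b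
  using elastic by unfold_locales (auto simp: periodic_elastic_structure_def)

abbreviation Y :: "(real^'n) measure" where "Y \<equiv> lebesgue_on cell"

abbreviation vol :: real where "vol \<equiv> measure lebesgue cell"

definition q :: "real^'n \<Rightarrow> 'n lin \<Rightarrow> real" where
  "q y A = blinfun_apply (C y) A \<bullet> A"

lemma periodic_C: "periodic b C"
  using elastic by (simp add: periodic_elastic_structure_def)

lemma C_measurable [measurable]: "C \<in> borel_measurable lebesgue"
  using elastic by (simp add: periodic_elastic_structure_def)

lemma C_minor:
  "A \<bullet> blinfun_apply (C y) B = A \<bullet> blinfun_apply (C y) (sym_part B)"
  "A \<bullet> blinfun_apply (C y) B = sym_part A \<bullet> blinfun_apply (C y) B"
  using elastic unfolding periodic_elastic_structure_def by blast+

text \<open>The minor symmetries reduce both arguments to their symmetric parts, which extends the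
  major symmetry to all matrices.\<close>

lemma C_symmetric: "A \<bullet> blinfun_apply (C y) B = B \<bullet> blinfun_apply (C y) A"
proof -
  have "sym_part A \<bullet> blinfun_apply (C y) (sym_part B) = sym_part B \<bullet> blinfun_apply (C y) (sym_part A)"
    using elastic sym_part_Sym unfolding periodic_elastic_structure_def by blast
  then show ?thesis
    using C_minor by metis
qed

lemma q_add: "q y (A + D) = q y A + 2 * (blinfun_apply (C y) A \<bullet> D) + q y D"
  using C_symmetric[of A y D]
  by (simp add: q_def blinfun.add_right inner_add_left inner_add_right inner_commute)

text \<open>The pointwise form of the standing bounds that the estimates use. Non-negativity on all
  matrices is convexity of the quadratic form \<open>q y\<close>.\<close>

definition good :: "real \<Rightarrow> real^'n \<Rightarrow> bool" where
  "good M y \<longleftrightarrow> norm (C y) \<le> M \<and> (\<forall>A. 0 \<le> q y A)"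

lemma good_translate: "good M (y + lat m) \<longleftrightarrow> good M y"
  by (simp add: good_def q_def periodic_lat[OF periodic_C])

lemma q_translate: "q (y + lat m) A = q y A"
  by (simp add: q_def periodic_lat[OF periodic_C])

text \<open>The bounds are given almost everywhere on the cell. Translations preserve null sets and
  the lattice is countable, so almost every y is good at all its translates inside the cell;
  periodicity transfers this back to y. Coercivity on \<open>Sym\<close> yields non-negativity on
  all matrices since q sees only the symmetric part.\<close>

lemma AE_good: obtains M where "M > 0" "AE y in lebesgue. good M y"
proof -
  obtain M where M: "M > 0" "AE y in Y. norm (C y) \<le> M"
    using elastic unfolding periodic_elastic_structure_def by blast
  obtain \<alpha> where a: "\<alpha> > 0" "AE y in Y. \<forall>E\<in>Sym. \<alpha> * (norm E)\<^sup>2 \<le> E \<bullet> blinfun_apply (C y) E"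
    using elastic unfolding periodic_elastic_structure_def by blast
  have "AE y in Y. good M y"
    using M(2) a(2)
  proof eventually_elim
    case (elim y)
    have "0 \<le> q y A" for A
    proof -
      have "0 \<le> \<alpha> * (norm (sym_part A))\<^sup>2"
        using a(1) by simp
      also have "\<dots> \<le> sym_part A \<bullet> blinfun_apply (C y) (sym_part A)"
        using elim(2) sym_part_Sym by blast
      also have "\<dots> = q y A"
        using C_minor[of A y A] C_minor(2)[of A y "sym_part A"] by (simp add: q_def inner_commute)
      finally show ?thesis .
    qed
    then show ?case
      using elim(1) by (simp add: good_def)
  qed
  then have *: "AE y in lebesgue. y \<in> cell \<longrightarrow> good M y"
    by (simp add: AE_restrict_space_iff)
  have "AE y in lebesgue. y + lat m \<in> cell \<longrightarrow> good M (y + lat m)" for m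
  proof -
    have "AE y in distr lebesgue lebesgue (\<lambda>y. lat m + mat 1 *v y). y \<in> cell \<longrightarrow> good M y"
      by (subst distr_lebesgue_affine) (use * in auto)
    from AE_distrD[OF distr_lebesgue_affine(1) this] show ?thesis
      by (simp add: add.commute)
  qed
  then have "AE y in lebesgue. \<forall>m. y + lat m \<in> cell \<longrightarrow> good M (y + lat m)"
    by (simp add: AE_all_countable)
  then have "AE y in lebesgue. good M y"
    by eventually_elim (use reduce_in_cell good_translate in blast)
  then show ?thesis
    using that M(1) by blast
qed

lemma q_le: "good M y \<Longrightarrow> q y A \<le> M * (norm A)\<^sup>2"
proof -
  assume "good M y"
  have "q y A \<le> norm (blinfun_apply (C y) A) * norm A"
    unfolding q_def by (rule norm_cauchy_schwarz)
  also have "\<dots> \<le> (norm (C y) * norm A) * norm A"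
    by (intro mult_right_mono norm_blinfun) auto
  also have "\<dots> \<le> (M * norm A) * norm A"
    using \<open>good M y\<close> by (intro mult_right_mono) (auto simp: good_def)
  finally show ?thesis
    by (simp add: power2_eq_square mult.assoc)
qed

lemma borel_measurable_stress:
  assumes "F \<in> borel_measurable lebesgue"
  shows "(\<lambda>y. blinfun_apply (C y) (F y)) \<in> borel_measurable lebesgue"
  by (rule borel_measurable_blinfun_apply[OF C_measurable assms])

lemma borel_measurable_q:
  assumes [measurable]: "F \<in> borel_measurable lebesgue"
  shows "(\<lambda>y. q y (F y)) \<in> borel_measurable lebesgue"
  unfolding q_def using borel_measurable_stress[OF assms] by measurable

lemma integrable_stress_inner:
  assumes F: "square_integrable cell F" and G: "square_integrable cell G"
  shows "integrable Y (\<lambda>y. blinfun_apply (C y) (F y) \<bullet> G y)"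
proof -
  obtain M where M: "M > 0" "AE y in lebesgue. good M y"
    using AE_good by blast
  have [measurable]: "C \<in> borel_measurable Y"
    by (rule measurable_restrict_space1[OF C_measurable])
  have [measurable]: "F \<in> borel_measurable Y" "G \<in> borel_measurable Y"
    using F G by (auto simp: square_integrable_def)
  have [measurable]: "(\<lambda>y. blinfun_apply (C y) (F y)) \<in> borel_measurable Y"
    by (rule borel_measurable_blinfun_apply) measurable
  have "integrable Y (\<lambda>y. M * ((norm (F y))\<^sup>2 + (norm (G y))\<^sup>2))"
    using F G by (auto simp: square_integrable_def)
  then show ?thesis
  proof (rule Bochner_Integration.integrable_bound)
    have "AE y in Y. good M y"
      using M(2) by (simp add: AE_restrict_space_iff) (auto elim: eventually_mono)
    then show "AE y in Y. norm (blinfun_apply (C y) (F y) \<bullet> G y)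
        \<le> norm (M * ((norm (F y))\<^sup>2 + (norm (G y))\<^sup>2))"
    proof eventually_elim
      case (elim y)
      have "\<bar>blinfun_apply (C y) (F y) \<bullet> G y\<bar> \<le> norm (blinfun_apply (C y) (F y)) * norm (G y)"
        by (rule Cauchy_Schwarz_ineq2)
      also have "\<dots> \<le> (norm (C y) * norm (F y)) * norm (G y)"
        by (intro mult_right_mono norm_blinfun) auto
      also have "\<dots> \<le> (M * norm (F y)) * norm (G y)"
        using elim by (intro mult_right_mono) (auto simp: good_def)
      also have "\<dots> \<le> M * ((norm (F y))\<^sup>2 + (norm (G y))\<^sup>2)"
        using M(1) sum_squares_bound[of "norm (F y)" "norm (G y)"]
        by (simp add: mult.assoc) (smt (verit) mult_nonneg_nonneg norm_ge_zero)
      finally show ?case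
        using M(1) by simp
    qed
  qed measurable
qed

lemma integrable_stress:
  assumes F: "square_integrable cell F"
  shows "integrable Y (\<lambda>y. blinfun_apply (C y) (F y))"
proof -
  have const: "square_integrable cell (\<lambda>_. A)" for A :: "'n lin"
    by (intro square_integrable_continuous continuous_on_const)
  have "integrable Y (\<lambda>y. \<Sum>i\<in>Basis. (blinfun_apply (C y) (F y) \<bullet> i) *\<^sub>R i)"
    by (intro Bochner_Integration.integrable_sum integrable_scaleR_left integrable_stress_inner F const)
  then show ?thesis
    by (simp add: euclidean_representation)
qed

lemma square_integrable_const: "square_integrable cell (\<lambda>_. A :: 'n lin)"
  by (intro square_integrable_continuous continuous_on_const)

lemma square_integrable_jacobian:
  fixes \<phi> :: "real^'n \<Rightarrow> real^'n"
  assumes "smooth \<phi>"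
  shows "square_integrable cell (\<lambda>y. jacobian \<phi> (at y))"
  by (intro square_integrable_continuous continuous_on_jacobian assms)

lemma H1_per_square_integrable: "(v, K) \<in> H1_per p b \<Longrightarrow> square_integrable cell K"
  by (simp add: H1_per_def)

section \<open>Correctors and the variational form of the macroscopic tensor\<close>

lemma integral_inner_stress:
  assumes F: "square_integrable cell F" and E: "square_integrable cell K"
  shows "(\<integral>y. blinfun_apply (C y) (F y) \<bullet> (A + K y) \<partial>Y)
    = A \<bullet> (\<integral>y. blinfun_apply (C y) (F y) \<partial>Y) + (\<integral>y. blinfun_apply (C y) (F y) \<bullet> K y \<partial>Y)"
  using integrable_stress[OF F] integrable_stress_inner[OF F E]
    integrable_stress_inner[OF F square_integrable_const[of A]]
  by (simp add: inner_add_right inner_commute[of A])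

text \<open>The cell problem for one gradient representative G in place of an equivalence class of
  pairs; the function itself enters only through membership in \<open>H1_per\<close>.\<close>

definition corrector :: "'n lin \<Rightarrow> (real^'n \<Rightarrow> 'n lin) \<Rightarrow> bool" where
  "corrector E G \<longleftrightarrow> (\<exists>w. (w, G) \<in> H1_per p b) \<and>
     (\<forall>(v, K)\<in>H1_per p b. (\<integral>y. blinfun_apply (C y) (E + G y) \<bullet> K y \<partial>Y) = 0)"

lemma corrector_square_integrable:
  "corrector E G \<Longrightarrow> square_integrable cell (\<lambda>y. E + G y)"
  unfolding corrector_def
  using square_integrable_add[OF square_integrable_const H1_per_square_integrable] by blast

lemma macroscopic_corrector:
  assumes mac: "macroscopic_elasticity_tensor p b C C0" and E: "E \<in> Sym"
  obtains G where "corrector E G"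
    and "vol *\<^sub>R C0 E = (\<integral>y. blinfun_apply (C y) (E + G y) \<partial>Y)"
proof -
  obtain W where W: "unit_cell_solution p b C E W"
    "\<forall>(w, G)\<in>W. C0 E = (1 / vol) *\<^sub>R (\<integral>y. blinfun_apply (C y) (E + G y) \<partial>Y)"
    using mac E unfolding macroscopic_elasticity_tensor_def by blast
  have "W \<in> H1_per p b // constant_shift_rel p b"
    using W(1) by (simp add: unit_cell_solution_def W_per_def)
  then obtain x where x: "x \<in> H1_per p b" "W = constant_shift_rel p b `` {x}"
    by (rule quotientE)
  obtain w G where wG: "x = (w, G)"
    by (cases x)
  \<comment> \<open>The shift c = 0 puts x into its own class. A member of W is needed because the
    formula for C0 is quantified over the members of W.\<close>
  have "(x, x) \<in> constant_shift_rel p b"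
    using x(1) unfolding wG constant_shift_rel_def by (auto intro!: exI[of _ 0])
  then have "(w, G) \<in> W"
    using x(2) wG by auto
  then have "corrector E G" "C0 E = (1 / vol) *\<^sub>R (\<integral>y. blinfun_apply (C y) (E + G y) \<partial>Y)"
    using W x(1) wG unfolding unit_cell_solution_def corrector_def by fast+
  then show ?thesis
    using that cell_measure_pos by simp
qed

text \<open>The cell equation removes K, so C0 can be tested with any admissible strain of mean part
  F. Choosing K as a corrector gives symmetry of C0; choosing F = E and K = G gives its
  energy.\<close>

lemma macroscopic_pairing:
  assumes cor: "corrector E G" and C0: "vol *\<^sub>R C0 E = (\<integral>y. blinfun_apply (C y) (E + G y) \<partial>Y)"
    and H1: "(v, K) \<in> H1_per p b"
  shows "(\<integral>y. blinfun_apply (C y) (E + G y) \<bullet> (F + K y) \<partial>Y) = vol * (F \<bullet> C0 E)"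
proof -
  have "(\<integral>y. blinfun_apply (C y) (E + G y) \<bullet> K y \<partial>Y) = 0"
    using cor H1 unfolding corrector_def by blast
  then show ?thesis
    using integral_inner_stress[OF corrector_square_integrable[OF cor] H1_per_square_integrable[OF H1], of F]
    unfolding C0[symmetric] by simp
qed

lemma macroscopic_symmetric:
  assumes mac: "macroscopic_elasticity_tensor p b C C0" and EF: "E \<in> Sym" "F \<in> Sym"
  shows "F \<bullet> C0 E = E \<bullet> C0 F"
proof -
  obtain G where G: "corrector E G" "vol *\<^sub>R C0 E = (\<integral>y. blinfun_apply (C y) (E + G y) \<partial>Y)"
    using macroscopic_corrector[OF mac EF(1)] .
  obtain K where K: "corrector F K" "vol *\<^sub>R C0 F = (\<integral>y. blinfun_apply (C y) (F + K y) \<partial>Y)"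
    using macroscopic_corrector[OF mac EF(2)] .
  obtain v w where H1: "(w, G) \<in> H1_per p b" "(v, K) \<in> H1_per p b"
    using G K unfolding corrector_def by blast
  have "vol * (F \<bullet> C0 E) = (\<integral>y. blinfun_apply (C y) (E + G y) \<bullet> (F + K y) \<partial>Y)"
    using macroscopic_pairing[of E G C0, OF G H1(2)] by simp
  also have "\<dots> = (\<integral>y. blinfun_apply (C y) (F + K y) \<bullet> (E + G y) \<partial>Y)"
    using C_symmetric by (simp add: inner_commute)
  also have "\<dots> = vol * (E \<bullet> C0 F)"
    using macroscopic_pairing[of F K C0, OF K H1(1)] by simp
  finally show ?thesis
    using cell_measure_pos by simp
qed

text \<open>The minor symmetry of C passes through the integral. This lets identities known for
  symmetric test matrices be extended to all matrices.\<close>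

lemma inner_C0_sym_part:
  assumes mac: "macroscopic_elasticity_tensor p b C C0" and E: "E \<in> Sym"
  shows "A \<bullet> C0 E = sym_part A \<bullet> C0 E"
proof -
  obtain G where G: "corrector E G" "vol *\<^sub>R C0 E = (\<integral>y. blinfun_apply (C y) (E + G y) \<partial>Y)"
    using macroscopic_corrector[OF mac E] .
  have int: "integrable Y (\<lambda>y. blinfun_apply (C y) (E + G y))"
    by (intro integrable_stress corrector_square_integrable G)
  have "vol * (A \<bullet> C0 E) = (\<integral>y. A \<bullet> blinfun_apply (C y) (E + G y) \<partial>Y)" for A
    using integral_inner_right[OF int, of A] by (simp add: G(2)[symmetric])
  then have "vol * (A \<bullet> C0 E) = vol * (sym_part A \<bullet> C0 E)"
    using C_minor(2) by simp
  then show ?thesis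
    using cell_measure_pos by simp
qed

text \<open>Completing the square around the corrector: both the gradient of phi and G are
  admissible in the cell equation, so the cross terms vanish. Non-negativity of the remainder gives
  the lower bound, density of smooth functions its sharpness.\<close>

lemma energy_identity:
  assumes cor: "corrector E G" and C0: "vol *\<^sub>R C0 E = (\<integral>y. blinfun_apply (C y) (E + G y) \<partial>Y)"
    and \<phi>: "smooth \<phi>" "periodic b \<phi>"
  shows "(\<integral>y. q y (E + jacobian \<phi> (at y)) \<partial>Y)
    = vol * (E \<bullet> C0 E) + (\<integral>y. q y (jacobian \<phi> (at y) - G y) \<partial>Y)"
proof -
  let ?J = "\<lambda>y. jacobian \<phi> (at y)"
  obtain w where H1: "(w, G) \<in> H1_per p b"
    using cor unfolding corrector_def by blast
  have J: "(\<phi>, ?J) \<in> H1_per p b"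
    by (rule smooth_periodic_in_H1_per[OF \<phi>])
  note si = corrector_square_integrable[OF cor] H1_per_square_integrable[OF H1] H1_per_square_integrable[OF J]
  have siD: "square_integrable cell (\<lambda>y. ?J y - G y)"
    by (rule square_integrable_diff[OF si(3,2)])
  have "q y (E + ?J y) = q y (E + G y) + 2 * (blinfun_apply (C y) (E + G y) \<bullet> ?J y
      - blinfun_apply (C y) (E + G y) \<bullet> G y) + q y (?J y - G y)" for y
    using q_add[of y "E + G y" "?J y - G y"] by (simp add: inner_diff_right)
  then have "(\<integral>y. q y (E + ?J y) \<partial>Y) = (\<integral>y. q y (E + G y) \<partial>Y)
      + 2 * ((\<integral>y. blinfun_apply (C y) (E + G y) \<bullet> ?J y \<partial>Y)
        - (\<integral>y. blinfun_apply (C y) (E + G y) \<bullet> G y \<partial>Y)) + (\<integral>y. q y (?J y - G y) \<partial>Y)"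
    using integrable_stress_inner[OF si(1) si(1)] integrable_stress_inner[OF si(1) si(2)]
      integrable_stress_inner[OF si(1) si(3)] integrable_stress_inner[OF siD siD]
    by (simp add: q_def)
  moreover have "(\<integral>y. blinfun_apply (C y) (E + G y) \<bullet> ?J y \<partial>Y) = 0"
    "(\<integral>y. blinfun_apply (C y) (E + G y) \<bullet> G y \<partial>Y) = 0"
    using cor H1 J unfolding corrector_def by fast+
  moreover have "(\<integral>y. q y (E + G y) \<partial>Y) = vol * (E \<bullet> C0 E)"
    using macroscopic_pairing[of E G C0, OF cor C0 H1] by (simp add: q_def)
  ultimately show ?thesis by simp
qed

lemma AE_good_cell:
  assumes "AE y in lebesgue. good M y"
  shows "AE y in Y. good M y"
  using assms by (simp add: AE_restrict_space_iff) (auto elim: eventually_mono)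

lemma energy_lower_bound:
  assumes mac: "macroscopic_elasticity_tensor p b C C0" and E: "E \<in> Sym"
    and \<phi>: "smooth \<phi>" "periodic b \<phi>"
  shows "vol * (E \<bullet> C0 E) \<le> (\<integral>y. q y (E + jacobian \<phi> (at y)) \<partial>Y)"
proof -
  obtain G where G: "corrector E G" "vol *\<^sub>R C0 E = (\<integral>y. blinfun_apply (C y) (E + G y) \<partial>Y)"
    using macroscopic_corrector[OF mac E] .
  obtain M where M: "AE y in lebesgue. good M y"
    using AE_good by blast
  have "0 \<le> (\<integral>y. q y (jacobian \<phi> (at y) - G y) \<partial>Y)"
    using AE_good_cell[OF M] by (intro integral_nonneg_AE) (auto simp: good_def elim: eventually_mono)
  then show ?thesis
    using energy_identity[of E G C0, OF G \<phi>] by simp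
qed

lemma energy_almost_attained:
  assumes mac: "macroscopic_elasticity_tensor p b C C0" and E: "E \<in> Sym" and e: "e > 0"
  obtains \<phi> where "smooth \<phi>" "periodic b \<phi>"
    "(\<integral>y. q y (E + jacobian \<phi> (at y)) \<partial>Y) \<le> vol * (E \<bullet> C0 E) + e"
proof -
  obtain G where G: "corrector E G" "vol *\<^sub>R C0 E = (\<integral>y. blinfun_apply (C y) (E + G y) \<partial>Y)"
    using macroscopic_corrector[OF mac E] .
  obtain M where M: "M > 0" "AE y in lebesgue. good M y"
    using AE_good by blast
  obtain w where H1: "(w, G) \<in> H1_per p b"
    using G(1) unfolding corrector_def by blast
  then obtain \<phi> :: "nat \<Rightarrow> real^'n \<Rightarrow> real^'n" where \<phi>: "\<And>k. smooth (\<phi> k)" "\<And>k. periodic b (\<phi> k)"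
    and lim: "(\<lambda>k. \<integral>y. (norm (\<phi> k y - w y))\<^sup>2 + (norm (jacobian (\<phi> k) (at y) - G y))\<^sup>2 \<partial>Y) \<longlonglongrightarrow> 0"
    and si: "square_integrable cell w" "square_integrable cell G"
    unfolding H1_per_def by blast
  \<comment> \<open>The tolerance is e / M because q is at most M times the squared norm. Smooth
    approximants of the corrector exist by the definition of \<open>H1_per\<close> as a
    closure.\<close>
  obtain k where k: "(\<integral>y. (norm (\<phi> k y - w y))\<^sup>2 + (norm (jacobian (\<phi> k) (at y) - G y))\<^sup>2 \<partial>Y) < e / M"
    using order_tendstoD(2)[OF lim, of "e / M"] e M(1) by (auto simp: eventually_sequentially)
  have siD: "square_integrable cell (\<lambda>y. \<phi> k y - w y)"
    "square_integrable cell (\<lambda>y. jacobian (\<phi> k) (at y) - G y)"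
    by (intro square_integrable_diff si square_integrable_jacobian \<phi>
        square_integrable_continuous smooth_imp_continuous_on)+
  have "(\<integral>y. q y (jacobian (\<phi> k) (at y) - G y) \<partial>Y)
      \<le> (\<integral>y. M * ((norm (\<phi> k y - w y))\<^sup>2 + (norm (jacobian (\<phi> k) (at y) - G y))\<^sup>2) \<partial>Y)"
  proof (rule integral_mono_AE)
    show "integrable Y (\<lambda>y. q y (jacobian (\<phi> k) (at y) - G y))"
      unfolding q_def by (intro integrable_stress_inner siD)
    show "integrable Y (\<lambda>y. M * ((norm (\<phi> k y - w y))\<^sup>2 + (norm (jacobian (\<phi> k) (at y) - G y))\<^sup>2))"
      using siD by (auto simp: square_integrable_def)
    show "AE y in Y. q y (jacobian (\<phi> k) (at y) - G y)
        \<le> M * ((norm (\<phi> k y - w y))\<^sup>2 + (norm (jacobian (\<phi> k) (at y) - G y))\<^sup>2)"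
      using AE_good_cell[OF M(2)]
    proof eventually_elim
      case (elim y)
      then have "q y (jacobian (\<phi> k) (at y) - G y) \<le> M * (norm (jacobian (\<phi> k) (at y) - G y))\<^sup>2"
        by (rule q_le)
      also have "\<dots> \<le> M * ((norm (\<phi> k y - w y))\<^sup>2 + (norm (jacobian (\<phi> k) (at y) - G y))\<^sup>2)"
        using M(1) by (intro mult_left_mono) auto
      finally show ?case .
    qed
  qed
  also have "\<dots> \<le> e"
    using k M(1) by (simp add: pos_less_divide_eq mult.commute less_imp_le)
  finally show ?thesis
    using that[OF \<phi>(1) \<phi>(2)] energy_identity[of E G C0, OF G \<phi>(1) \<phi>(2)] by simp
qed

text \<open>Expanding q around the mean D, the linear terms add up to zero and the quadratic
  remainders are non-negative.\<close>

lemma Jensen_q: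
  assumes "good M y" and I: "finite I" "I \<noteq> {}"
  shows "real (card I) * q y ((1 / real (card I)) *\<^sub>R (\<Sum>m\<in>I. A m)) \<le> (\<Sum>m\<in>I. q y (A m))"
proof -
  define D where "D = (1 / real (card I)) *\<^sub>R (\<Sum>m\<in>I. A m)"
  have sumA: "(\<Sum>m\<in>I. A m) = real (card I) *\<^sub>R D"
    using I by (simp add: D_def)
  have "q y (A m) = q y D + 2 * (blinfun_apply (C y) D \<bullet> (A m - D)) + q y (A m - D)" for m
    using q_add[of y D "A m - D"] by simp
  then have "(\<Sum>m\<in>I. q y (A m)) = real (card I) * q y D
      + 2 * (blinfun_apply (C y) D \<bullet> (\<Sum>m\<in>I. A m - D)) + (\<Sum>m\<in>I. q y (A m - D))"
    by (simp add: sum.distrib inner_sum_right sum_distrib_left)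
  also have "(\<Sum>m\<in>I. A m - D) = 0"
    using sumA by (simp add: sum_subtractf sum_constant_scaleR del: sum_constant)
  finally show ?thesis
    using assms(1) by (simp add: D_def good_def sum_nonneg)
qed

end

section \<open>Averaging over the lattice\<close>

lemma jacobian_mult:
  fixes f :: "real^'n \<Rightarrow> real^'m"
  assumes "smooth f" "(f has_derivative f') (at x)"
  shows "jacobian f (at x) *v u = f' u"
  using has_derivative_unique[OF has_derivative_jacobian[OF assms(1)] assms(2)] by metis

lemma borel_measurable_jacobian:
  fixes f :: "real^'n \<Rightarrow> real^'m"
  assumes "smooth f"
  shows "(\<lambda>x. jacobian f (at x)) \<in> borel_measurable lebesgue"
  by (rule measurable_completion)
    (simp add: borel_measurable_continuous_onI[OF continuous_on_jacobian[OF assms]])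

context elastic_structure
begin

text \<open>
  Cutting \<open>\<psi>\<close> off inside a block of \<open>N\<^sup>n\<close> cells and averaging over the lattice gives a periodic
  function. By convexity its mean energy is at most that of the cut-off function, which
  differs from that of \<open>\<psi>\<close> only in a boundary layer.
\<close>

lemma averaged_competitor:
  fixes \<psi> :: "real^'n \<Rightarrow> real^'n" and E :: "'n lin"
  assumes \<psi>: "smooth \<psi>" and R0: "\<And>x. norm (\<psi> x) \<le> R0" and R1: "\<And>x u. norm (\<psi>' x u) \<le> R1 * norm u"
    and der: "\<And>x. (\<psi> has_derivative \<psi>' x) (at x)" and pos: "R0 > 0" "R1 > 0"
  obtains K where "K \<ge> 0"
    "\<And>N. N \<ge> 6 \<Longrightarrow> \<exists>\<phi>. smooth \<phi> \<and> periodic b \<phi> \<and>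
      of_nat (N ^ CARD('n)) * (\<integral>\<^sup>+y. ennreal (q y (E + jacobian \<phi> (at y))) * indicator cell y \<partial>lebesgue)
      \<le> (\<integral>\<^sup>+y. ennreal (q y (E + jacobian \<psi> (at y))) * indicator (block 0 (real N)) y \<partial>lebesgue)
        + ennreal (K * (real N ^ CARD('n) - (real N - 6) ^ CARD('n)) * vol)"
proof -
  obtain M where M: "M > 0" "AE y in lebesgue. good M y"
    using AE_good by blast
  obtain K1 :: real where cut: "\<And>T. \<exists>w w'. smooth w \<and> (\<forall>x. 0 \<le> w x \<and> w x \<le> 1) \<and>
    (\<forall>x. x \<notin> block 1 (T - 1) \<longrightarrow> w x = 0) \<and> (\<forall>x\<in>block 2 (T - 2). w x = 1) \<and>
    (\<forall>x. (w has_derivative w' x) (at x)) \<and> (\<forall>x u. \<bar>w' x u\<bar> \<le> K1 * norm u)"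
    using cutoff_exists by blast
  \<comment> \<open>Bounds the gradient of the cut-off function: R1 comes from the gradient of psi,
    K1 * R0 from that of the cut-off multiplying psi, and the two factors n from
    \<open>norm_matrix_le\<close>. It does not depend on N.\<close>
  define L where "L = real CARD('n) * (real CARD('n) * (R1 + K1 * R0))"
  define K where "K = M * (norm E + L)\<^sup>2"
  show ?thesis
  proof (rule that[of K])
    show "K \<ge> 0"
      using M(1) by (simp add: K_def)
  next
    \<comment> \<open>6 is twice the margin 3. The cut-off starts at depth 1 and is complete at
      depth 2; one more unit leaves room for open neighbourhoods. The core
      \<open>block 3 (real N - 3)\<close> then has non-negative side.\<close>
    fix N :: nat assume N: "N \<ge> 6"
    obtain w w' where w: "smooth w" "\<And>x. 0 \<le> w x" "\<And>x. w x \<le> 1"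
      "\<And>x. x \<notin> block 1 (real N - 1) \<Longrightarrow> w x = 0" "\<And>x. x \<in> block 2 (real N - 2) \<Longrightarrow> w x = 1"
      "\<And>x. (w has_derivative w' x) (at x)" "\<And>x u. \<bar>w' x u\<bar> \<le> K1 * norm u"
      using cut[of "real N"] by blast
    define \<theta> where "\<theta> x = w x *\<^sub>R \<psi> x" for x
    define J where "J x = jacobian \<theta> (at x)" for x
    have \<theta>: "smooth \<theta>"
      using w(1) \<psi> unfolding smooth_def \<theta>_def[abs_def] by (intro allI C_k_scaleR) auto
    have J: "(\<theta> has_derivative (\<lambda>u. J x *v u)) (at x)" for x
      unfolding J_def by (rule has_derivative_jacobian[OF \<theta>])
    have Jd: "J x *v u = w x *\<^sub>R \<psi>' x u + w' x u *\<^sub>R \<psi> x" for x u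
      unfolding J_def
      by (rule jacobian_mult[OF \<theta>]) (use has_derivative_scaleR[OF w(6) der] in \<open>simp add: \<theta>_def[abs_def]\<close>)
    have normJ: "norm (J x) \<le> L" for x
      unfolding L_def
    proof (rule norm_matrix_le)
      fix u
      have "norm (J x *v u) \<le> \<bar>w x\<bar> * norm (\<psi>' x u) + \<bar>w' x u\<bar> * norm (\<psi> x)"
        unfolding Jd by (metis norm_scaleR norm_triangle_ineq)
      also have "\<dots> \<le> 1 * (R1 * norm u) + (K1 * norm u) * R0"
        using w(2,3)[of x] w(7)[of x u] R0[of x] R1[of x u]
        by (intro add_mono mult_mono) (auto intro: order_trans[OF abs_ge_zero])
      finally show "norm (J x *v u) \<le> (R1 + K1 * R0) * norm u"
        by (simp add: algebra_simps)
    qed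
    \<comment> \<open>The function vanishes up to depth 1 inside the block, so every point outside
      the block has an open neighbourhood on which it is zero.\<close>
    have J0: "J x = 0" if x: "x \<notin> block 0 (real N)" for x
    proof -
      let ?U = "{x. \<exists>i. coord x $ i < 1 \<or> real N - 1 < coord x $ i}"
      have "open ?U"
        by (intro open_Collect_ex open_Collect_disj open_Collect_less continuous_on_coord_nth continuous_intros)
      moreover have "x \<in> ?U"
        using x by (auto simp: block_def not_le not_less) (smt (verit))+
      moreover have "\<theta> y = 0" if "y \<in> ?U" for y
        using that w(4)[of y] unfolding \<theta>_def block_def by (auto simp: not_le not_less) (smt (verit) mem_Collect_eq)+
      ultimately have "((\<lambda>y. 0) has_derivative (\<lambda>u. J x *v u)) (at x)"
        using has_derivative_transform_within_open[OF J[of x], where s = ?U and g = "\<lambda>_. 0"] by auto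
      then have "J x *v u = 0" for u
        using has_derivative_unique[OF _ has_derivative_const] by metis
      then show ?thesis
        by (metis matrix_eq matrix_vector_mult_0)
    qed
    \<comment> \<open>Depth 3 lies inside the open region of depth more than 2, where the cut-off is
      identically 1 and the derivatives must agree.\<close>
    have Jin: "J x = jacobian \<psi> (at x)" if x: "x \<in> block 3 (real N - 3)" for x
    proof -
      let ?U = "{x. \<forall>i. 2 < coord x $ i \<and> coord x $ i < real N - 2}"
      have "?U = coord -` box (\<chi> i. 2) (\<chi> i. real N - 2)"
        by (auto simp: mem_box_cart)
      then have "open ?U"
        using open_vimage[OF open_box continuous_on_coord] by metis
      moreover have "x \<in> ?U"
        using x by (auto simp: block_def) (smt (verit))+
      moreover have "\<psi> y = \<theta> y" if "y \<in> ?U" for y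
        using that w(5)[of y] unfolding \<theta>_def block_def by (auto simp: less_imp_le)
      ultimately have "(\<theta> has_derivative (\<lambda>u. jacobian \<psi> (at x) *v u)) (at x)"
        using has_derivative_transform_within_open[OF has_derivative_jacobian[OF \<psi>], where s = ?U and g = \<theta>] by auto
      then show ?thesis
        unfolding J_def by (rule jacobian_eqI)
    qed
    obtain R where R: "\<And>x. x \<in> block 0 (real N) \<Longrightarrow> norm x \<le> R"
      using bounded_block[of 0 "real N"] unfolding bounded_iff by blast
    have supp: "\<theta> x = 0" if x: "norm x > R" for x
    proof -
      have "x \<notin> block 1 (real N - 1)"
        using R[of x] x by (auto simp: block_def) (smt (verit))
      then show ?thesis
        by (simp add: \<theta>_def w(4))
    qed
    define n where "n = N ^ CARD('n)"
    have n: "n > 0" "card (grid N) = n"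
      using N by (auto simp: n_def card_grid)
    define \<phi> where "\<phi> x = (1 / real n) *\<^sub>R periodize \<theta> x" for x
    have "smooth \<phi>"
      using smooth_periodize[OF \<theta> supp] C_k_bounded_linear_compose[OF bounded_linear_scaleR_right]
      unfolding smooth_def \<phi>_def[abs_def] by blast
    have "periodic b \<phi>"
      using periodic_periodize[of \<theta>] by (simp add: periodic_def \<phi>_def)
    \<comment> \<open>From a point of the cell exactly the labels in \<open>grid N\<close> lead into
      the block, and all other translates contribute zero gradient. The average thus has N^n
      terms.\<close>
    have J\<phi>: "jacobian \<phi> (at y) = (1 / real n) *\<^sub>R (\<Sum>m\<in>grid N. J (y + lat m))"
      if y: "y \<in> cell" for y
    proof (rule jacobian_eqI)
      have "periodize (\<lambda>z. J z *v u) y = (\<Sum>m\<in>grid N. J (y + lat m) *v u)" for u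
      proof (rule periodize_eq_sum[OF finite_grid])
        fix m assume "J (y + lat m) *v u \<noteq> 0"
        then have "y + lat m \<in> block 0 (real N)"
          using J0 by force
        then show "m \<in> grid N"
          using y unfolding idx_grid[symmetric] by (simp add: cell_iff_idx idx_add_lat)
      qed
      moreover have "(\<Sum>m\<in>grid N. J (y + lat m) *v u) = (\<Sum>m\<in>grid N. J (y + lat m)) *v u" for u
        using linear_sum[of "\<lambda>A. A *v u" "\<lambda>m. J (y + lat m)" "grid N"]
        by (simp add: linear_iff matrix_vector_mult_add_rdistrib scaleR_matrix_vector_assoc)
      ultimately have "(periodize \<theta> has_derivative (\<lambda>u. (\<Sum>m\<in>grid N. J (y + lat m)) *v u)) (at y)"
        using periodize_has_derivative[of R \<theta>, OF supp J, of y] by simp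
      from has_derivative_scaleR_right[OF this, of "1 / real n"]
      show "(\<phi> has_derivative (\<lambda>u. ((1 / real n) *\<^sub>R (\<Sum>m\<in>grid N. J (y + lat m))) *v u)) (at y)"
        by (simp add: \<phi>_def[abs_def] scaleR_matrix_vector_assoc)
    qed
    define g where "g y = ennreal (q y (E + J y))" for y
    have Jm: "J \<in> borel_measurable lebesgue"
      unfolding J_def[abs_def] by (rule borel_measurable_jacobian[OF \<theta>])
    have gm [measurable]: "g \<in> borel_measurable lebesgue"
      unfolding g_def[abs_def] using borel_measurable_q[of "\<lambda>y. E + J y"] Jm by measurable
    have [measurable]: "block r s \<in> sets lebesgue" for r s
      by (rule borel_in_lebesgue[OF block_sets_borel])
    \<comment> \<open>Jensen is applied pointwise: E is its own average, and periodicity of q lets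
      all translates be measured by the same quadratic form at y.\<close>
    have "of_nat n * (\<integral>\<^sup>+y. ennreal (q y (E + jacobian \<phi> (at y))) * indicator cell y \<partial>lebesgue)
        \<le> (\<Sum>m\<in>grid N. \<integral>\<^sup>+y. g (y + lat m) * indicator cell y \<partial>lebesgue)"
    proof -
      have "AE y in lebesgue. of_nat n * (ennreal (q y (E + jacobian \<phi> (at y))) * indicator cell y)
          \<le> (\<Sum>m\<in>grid N. g (y + lat m) * indicator cell y)"
        using M(2)
      proof eventually_elim
        case (elim y)
        show ?case
        proof (cases "y \<in> cell")
          case True
          have "E + jacobian \<phi> (at y) = (1 / real (card (grid N))) *\<^sub>R (\<Sum>m\<in>grid N. E + J (y + lat m))"
            using n by (simp add: J\<phi>[OF True] sum.distrib sum_constant_scaleR scaleR_add_right del: sum_constant)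
          moreover have "grid N \<noteq> {}"
            using n by auto
          ultimately have "real n * q y (E + jacobian \<phi> (at y)) \<le> (\<Sum>m\<in>grid N. q y (E + J (y + lat m)))"
            using Jensen_q[OF elim finite_grid, of N "\<lambda>m. E + J (y + lat m)"] n by simp
          then have "ennreal (real n * q y (E + jacobian \<phi> (at y)))
              \<le> (\<Sum>m\<in>grid N. ennreal (q y (E + J (y + lat m))))"
            using elim by (simp add: good_def sum_ennreal ennreal_leI)
          then show ?thesis
            using True elim by (simp add: g_def q_translate ennreal_mult' ennreal_of_nat_eq_real_of_nat good_def)
        qed simp
      qed
      then have "(\<integral>\<^sup>+y. of_nat n * (ennreal (q y (E + jacobian \<phi> (at y))) * indicator cell y) \<partial>lebesgue)
          \<le> (\<integral>\<^sup>+y. (\<Sum>m\<in>grid N. g (y + lat m) * indicator cell y) \<partial>lebesgue)"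
        by (rule nn_integral_mono_AE)
      moreover have "(\<lambda>y. ennreal (q y (E + jacobian \<phi> (at y)))) \<in> borel_measurable lebesgue"
      proof -
        have "(\<lambda>y. jacobian \<phi> (at y)) \<in> borel_measurable lebesgue"
          by (rule borel_measurable_jacobian[OF \<open>smooth \<phi>\<close>])
        then show ?thesis
          using borel_measurable_q[of "\<lambda>y. E + jacobian \<phi> (at y)"] by measurable
      qed
      moreover have "(\<lambda>y. g (y + lat m)) \<in> borel_measurable lebesgue" for m
        by (rule measurable_lebesgue_translate[OF gm])
      ultimately show ?thesis
        by (simp add: nn_integral_cmult nn_integral_sum)
    qed
    also have "\<dots> = (\<integral>\<^sup>+y. g y * indicator (block 0 (real N)) y \<partial>lebesgue)"
      using nn_integral_tiles[OF gm finite_grid, of N] by (simp add: idx_grid)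
    \<comment> \<open>On the core the cut-off energy is that of psi; on the remaining layer the
      crude bound K suffices.\<close>
    also have "\<dots> \<le> (\<integral>\<^sup>+y. ennreal (q y (E + jacobian \<psi> (at y))) * indicator (block 0 (real N)) y
        + ennreal K * indicator (block 0 (real N) - block 3 (real N - 3)) y \<partial>lebesgue)"
    proof (rule nn_integral_mono_AE)
      show "AE y in lebesgue. g y * indicator (block 0 (real N)) y
        \<le> ennreal (q y (E + jacobian \<psi> (at y))) * indicator (block 0 (real N)) y
        + ennreal K * indicator (block 0 (real N) - block 3 (real N - 3)) y"
        using M(2)
      proof eventually_elim
        case (elim y)
        have "q y (E + J y) \<le> M * (norm (E + J y))\<^sup>2"
          by (rule q_le[OF elim])
        also have "\<dots> \<le> K"
          unfolding K_def using M(1) normJ[of y] norm_triangle_ineq[of E "J y"]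
          by (intro mult_left_mono power_mono) auto
        finally have "g y \<le> ennreal K"
          unfolding g_def by (rule ennreal_leI)
        then show ?case
          using Jin[of y] by (auto simp: indicator_def g_def add_increasing)
      qed
    qed
    also have "\<dots> = (\<integral>\<^sup>+y. ennreal (q y (E + jacobian \<psi> (at y))) * indicator (block 0 (real N)) y \<partial>lebesgue)
        + ennreal K * emeasure lebesgue (block 0 (real N) - block 3 (real N - 3))"
    proof -
      have "(\<lambda>y. jacobian \<psi> (at y)) \<in> borel_measurable lebesgue"
        by (rule borel_measurable_jacobian[OF \<psi>])
      then have [measurable]: "(\<lambda>y. q y (E + jacobian \<psi> (at y))) \<in> borel_measurable lebesgue"
        by (intro borel_measurable_q) measurable
      show ?thesis
        by (simp add: nn_integral_add nn_integral_cmult)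
    qed
    also have "emeasure lebesgue (block 0 (real N) - block 3 (real N - 3))
        = ennreal ((real N ^ CARD('n) - (real N - 6) ^ CARD('n)) * vol)"
    proof -
      have "block 3 (real N - 3) \<subseteq> block 0 (real N)"
        by (auto simp: block_def) (smt (verit))+
      moreover have e: "emeasure lebesgue (block r s) = ennreal ((s - r) ^ CARD('n) * vol)" if "r \<le> s" for r s
        unfolding emeasure_block[OF that] emeasure_cell using that by (simp add: ennreal_mult')
      moreover have "emeasure lebesgue (block 3 (real N - 3)) \<noteq> \<infinity>"
        using N by (subst e) auto
      ultimately have "emeasure lebesgue (block 0 (real N) - block 3 (real N - 3))
          = ennreal ((real N - 0) ^ CARD('n) * vol) - ennreal ((real N - 3 - 3) ^ CARD('n) * vol)"
        using N by (subst emeasure_Diff) (auto simp: e)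
      also have "\<dots> = ennreal ((real N ^ CARD('n) - (real N - 6) ^ CARD('n)) * vol)"
        using N by (subst ennreal_minus) (auto simp: left_diff_distrib)
      finally show ?thesis .
    qed
    also have "ennreal K * ennreal ((real N ^ CARD('n) - (real N - 6) ^ CARD('n)) * vol)
        = ennreal (K * (real N ^ CARD('n) - (real N - 6) ^ CARD('n)) * vol)"
      using M(1) by (simp add: ennreal_mult'[symmetric] K_def mult.assoc)
    finally show "\<exists>\<phi>. smooth \<phi> \<and> periodic b \<phi> \<and>
      of_nat (N ^ CARD('n)) * (\<integral>\<^sup>+y. ennreal (q y (E + jacobian \<phi> (at y))) * indicator cell y \<partial>lebesgue)
      \<le> (\<integral>\<^sup>+y. ennreal (q y (E + jacobian \<psi> (at y))) * indicator (block 0 (real N)) y \<partial>lebesgue)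
        + ennreal (K * (real N ^ CARD('n) - (real N - 6) ^ CARD('n)) * vol)"
      using \<open>smooth \<phi>\<close> \<open>periodic b \<phi>\<close> unfolding n_def by blast
  qed
qed

end

section \<open>Invariance of the macroscopic tensor\<close>

text \<open>Used with a = 2k for the cells met by the image of a block, and with a = -6 for the
  undisturbed core.\<close>

lemma tendsto_shifted_ratio: "(\<lambda>N. (real N + a) ^ d / real N ^ d) \<longlonglongrightarrow> 1"
proof -
  have "(\<lambda>N. (1 + a * inverse (real N)) ^ d) \<longlonglongrightarrow> (1 + a * 0) ^ d"
    by (intro tendsto_intros lim_inverse_n)
  moreover have "\<forall>\<^sub>F N in sequentially. (1 + a * inverse (real N)) ^ d = (real N + a) ^ d / real N ^ d"
    using eventually_gt_at_top[of 0]
  proof eventually_elim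
    case (elim N)
    then have "1 + a * inverse (real N) = (real N + a) / real N"
      by (simp add: field_simps)
    then show ?case
      by (simp add: power_divide)
  qed
  ultimately show ?thesis
    by (simp add: tendsto_cong)
qed

lemma pull_pull: "pull H (pull G A) = pull (G ** H) A"
  by (simp add: pull_def matrix_transpose_mul matrix_mul_assoc)

lemma pull_one: "pull (mat 1) A = A"
  by (simp add: pull_def)

context elastic_structure
begin

text \<open>Connects the non-negative integrals of the tiling argument with the Bochner integrals
  that define C0: energies of smooth functions are integrable and almost everywhere
  non-negative.\<close>

lemma nn_integral_energy:
  fixes \<phi> :: "real^'n \<Rightarrow> real^'n"
  assumes "smooth \<phi>"
  shows "(\<integral>\<^sup>+y. ennreal (q y (E + jacobian \<phi> (at y))) * indicator cell y \<partial>lebesgue)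
      = ennreal (\<integral>y. q y (E + jacobian \<phi> (at y)) \<partial>Y)"
    and "0 \<le> (\<integral>y. q y (E + jacobian \<phi> (at y)) \<partial>Y)"
proof -
  obtain M where M: "AE y in lebesgue. good M y"
    using AE_good by blast
  have nonneg: "AE y in Y. 0 \<le> q y (E + jacobian \<phi> (at y))"
    using AE_good_cell[OF M] by eventually_elim (simp add: good_def)
  then show "0 \<le> (\<integral>y. q y (E + jacobian \<phi> (at y)) \<partial>Y)"
    by (rule integral_nonneg_AE)
  have si: "square_integrable cell (\<lambda>y. E + jacobian \<phi> (at y))"
    by (intro square_integrable_add square_integrable_const square_integrable_jacobian assms)
  have "integrable Y (\<lambda>y. q y (E + jacobian \<phi> (at y)))"
    unfolding q_def by (rule integrable_stress_inner[OF si si])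
  then have "(\<integral>\<^sup>+y. ennreal (q y (E + jacobian \<phi> (at y))) \<partial>Y) = ennreal (\<integral>y. q y (E + jacobian \<phi> (at y)) \<partial>Y)"
    using nonneg by (rule nn_integral_eq_integral)
  then show "(\<integral>\<^sup>+y. ennreal (q y (E + jacobian \<phi> (at y))) * indicator cell y \<partial>lebesgue)
      = ennreal (\<integral>y. q y (E + jacobian \<phi> (at y)) \<partial>Y)"
    by (simp add: nn_integral_restrict_space)
qed

text \<open>The order of limits matters: e fixes phi and with it the constant K of the boundary
  layer; N tends to infinity with phi fixed, and only then does e tend to zero.\<close>

lemma macroscopic_energy_pull_le:
  assumes mac: "macroscopic_elasticity_tensor p b C C0" and E: "E \<in> Sym"
    and H: "\<bar>det H\<bar> = 1" and inv: "\<And>y A. q (c + H *v y) A = q y (pull H A)"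
  shows "pull H E \<bullet> C0 (pull H E) \<le> E \<bullet> C0 E"
proof -
  let ?n = "CARD('n)"
  let ?h = "\<lambda>y. c + H *v y"
  have "vol * (pull H E \<bullet> C0 (pull H E)) \<le> vol * (E \<bullet> C0 E) + e" if e: "e > 0" for e
  proof -
    obtain \<phi> where \<phi>: "smooth \<phi>" "periodic b \<phi>"
      and en: "(\<integral>y. q y (E + jacobian \<phi> (at y)) \<partial>Y) \<le> vol * (E \<bullet> C0 E) + e"
      using energy_almost_attained[OF mac E e] .
    let ?D = "\<lambda>x. frechet_derivative \<phi> (at x)"
    \<comment> \<open>The chain rule multiplies the gradient by H on the right; the outer factor
      \<open>transpose H\<close> completes this to \<open>pull H\<close>, the form in which strains
      enter the symmetry.\<close>
    define \<psi> where "\<psi> y = transpose H *v \<phi> (?h y)" for y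
    define \<psi>' where "\<psi>' y u = transpose H *v (?D (?h y) (H *v u))" for y u
    have h': "(?h has_derivative (\<lambda>u. H *v u)) (at y)" for y
      using has_derivative_add[OF has_derivative_const
          bounded_linear_imp_has_derivative[OF matrix_vector_mul_bounded_linear[of H]]] by simp
    have der: "(\<psi> has_derivative \<psi>' y) (at y)" for y
      unfolding \<psi>_def[abs_def] \<psi>'_def[abs_def]
      by (rule bounded_linear.has_derivative[OF matrix_vector_mul_bounded_linear
            has_derivative_compose[OF h' smooth_has_derivative[OF \<phi>(1)]]])
    have "C_k k (\<lambda>y. transpose H *v \<phi> (H *v y + c))" for k
      using \<phi>(1) unfolding smooth_def
      by (intro C_k_bounded_linear_compose[OF matrix_vector_mul_bounded_linear]
          C_k_affine_compose[OF matrix_vector_mul_bounded_linear]) blast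
    then have \<psi>: "smooth \<psi>"
      unfolding smooth_def \<psi>_def[abs_def] by (simp add: add.commute)
    have J\<psi>: "jacobian \<psi> (at y) = pull H (jacobian \<phi> (at (?h y)))" for y
    proof (rule jacobian_eqI)
      have "\<psi>' y = (\<lambda>u. pull H (jacobian \<phi> (at (?h y))) *v u)"
        using jacobian_mult[OF \<phi>(1) smooth_has_derivative[OF \<phi>(1)], of "?h y"]
        by (simp add: fun_eq_iff \<psi>'_def pull_def matrix_vector_mul_assoc[symmetric])
      then show "(\<psi> has_derivative (\<lambda>u. pull H (jacobian \<phi> (at (?h y))) *v u)) (at y)"
        using der by metis
    qed
    obtain L where L: "\<And>x. norm (H *v x) \<le> L * norm x" "L > 0"
      using linear_bounded_pos[OF matrix_vector_mul_linear[of H]] by auto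
    obtain Lt where Lt: "\<And>x. norm (transpose H *v x) \<le> Lt * norm x" "Lt > 0"
      using linear_bounded_pos[OF matrix_vector_mul_linear[of "transpose H"]] by auto
    obtain R0 where R0: "\<And>x. norm (\<phi> x) \<le> R0" "R0 > 0"
      using periodic_continuous_bounded[OF smooth_imp_continuous_on[OF \<phi>(1)] \<phi>(2)] by blast
    obtain R1 where R1: "\<And>x u. norm (?D x u) \<le> R1 * norm u" "R1 > 0"
      using periodic_derivative_bounded[OF \<phi>] by blast
    have b0: "norm (\<psi> x) \<le> Lt * R0" for x
      unfolding \<psi>_def by (rule order_trans[OF Lt(1) mult_left_mono[OF R0(1)]]) (use Lt(2) in simp)
    have b1: "norm (\<psi>' x u) \<le> Lt * (R1 * L) * norm u" for x u
    proof -
      have "norm (\<psi>' x u) \<le> Lt * norm (?D (?h x) (H *v u))"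
        unfolding \<psi>'_def by (rule Lt)
      also have "\<dots> \<le> Lt * (R1 * norm (H *v u))"
        using Lt(2) by (intro mult_left_mono R1) auto
      also have "\<dots> \<le> Lt * (R1 * (L * norm u))"
        using Lt(2) R1(2) by (intro mult_left_mono L) auto
      finally show ?thesis by (simp add: mult.assoc)
    qed
    have pos: "Lt * R0 > 0" "Lt * (R1 * L) > 0"
      using Lt(2) R0(2) R1(2) L(2) by simp_all
    obtain K where K: "K \<ge> 0" "\<And>N. N \<ge> 6 \<Longrightarrow> \<exists>\<phi>. smooth \<phi> \<and> periodic b \<phi> \<and>
      of_nat (N ^ ?n) * (\<integral>\<^sup>+y. ennreal (q y (pull H E + jacobian \<phi> (at y))) * indicator cell y \<partial>lebesgue)
      \<le> (\<integral>\<^sup>+y. ennreal (q y (pull H E + jacobian \<psi> (at y))) * indicator (block 0 (real N)) y \<partial>lebesgue)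
        + ennreal (K * (real N ^ ?n - (real N - 6) ^ ?n) * vol)"
      using averaged_competitor[OF \<psi> b0 b1 der pos, where E = "pull H E"] by blast
    \<comment> \<open>The energy density of psi is f composed with the affine map. That composition
      need not be periodic, but f is, so the cell count applies to f.\<close>
    define f where "f z = ennreal (q z (E + jacobian \<phi> (at z)))" for z
    have fm: "f \<in> borel_measurable lebesgue"
      unfolding f_def[abs_def] using borel_measurable_q[of "\<lambda>y. E + jacobian \<phi> (at y)"]
        borel_measurable_jacobian[OF \<phi>(1)] by measurable
    have fp: "periodic b f"
    proof -
      have "periodic b ?D"
        by (rule periodic_frechet_derivative[OF \<phi>(2) smooth_has_derivative[OF \<phi>(1)]])
      then show ?thesis
        using periodic_C unfolding f_def[abs_def] q_def jacobian_def periodic_def by simp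
    qed
    have f\<psi>: "ennreal (q y (pull H E + jacobian \<psi> (at y))) = f (?h y)" for y
      by (simp add: f_def inv J\<psi> pull_add)
    obtain k :: nat where k: "\<And>N f. f \<in> borel_measurable lebesgue \<Longrightarrow> periodic b f \<Longrightarrow>
      (\<integral>\<^sup>+x. f (?h x) * indicator (block 0 (real N)) x \<partial>lebesgue)
      \<le> of_nat ((N + 2 * k) ^ ?n) * (\<integral>\<^sup>+x. f x * indicator cell x \<partial>lebesgue)"
      using nn_integral_affine_block_le[OF H, of c] by blast
    define e0 where "e0 = (\<integral>y. q y (E + jacobian \<phi> (at y)) \<partial>Y)"
    have e0: "e0 \<ge> 0" "(\<integral>\<^sup>+x. f x * indicator cell x \<partial>lebesgue) = ennreal e0"
      unfolding f_def e0_def using nn_integral_energy[OF \<phi>(1)] by auto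
    define m where "m = vol * (pull H E \<bullet> C0 (pull H E))"
    \<comment> \<open>The first summand accounts for the cells met by the image of the block, the
      second for the boundary layer, both relative to N^n. Writing \<open>+ (- 6)\<close> matches
      \<open>tendsto_shifted_ratio\<close>.\<close>
    have bound: "m \<le> (real N + 2 * real k) ^ ?n / real N ^ ?n * e0
        + K * (1 - (real N + (- 6)) ^ ?n / real N ^ ?n) * vol" if N: "N \<ge> 6" for N
    proof -
      obtain \<eta> where \<eta>: "smooth \<eta>" "periodic b \<eta>"
        and le: "of_nat (N ^ ?n) * (\<integral>\<^sup>+y. ennreal (q y (pull H E + jacobian \<eta> (at y))) * indicator cell y \<partial>lebesgue)
          \<le> (\<integral>\<^sup>+y. f (?h y) * indicator (block 0 (real N)) y \<partial>lebesgue)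
            + ennreal (K * (real N ^ ?n - (real N - 6) ^ ?n) * vol)"
        using K(2)[OF N] unfolding f\<psi> by blast
      define e1 where "e1 = (\<integral>y. q y (pull H E + jacobian \<eta> (at y)) \<partial>Y)"
      have e1: "e1 \<ge> 0" "m \<le> e1"
        unfolding e1_def m_def using nn_integral_energy[OF \<eta>(1)] energy_lower_bound[OF mac pull_Sym[OF E] \<eta>] by auto
      have r: "0 \<le> K * (real N ^ ?n - (real N - 6) ^ ?n) * vol"
        using K(1) N by (intro mult_nonneg_nonneg) (auto intro!: power_mono)
      have "of_nat (N ^ ?n) * ennreal e1 \<le> of_nat ((N + 2 * k) ^ ?n) * ennreal e0
          + ennreal (K * (real N ^ ?n - (real N - 6) ^ ?n) * vol)"
        using order_trans[OF le add_right_mono[OF k[OF fm fp]]]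
        unfolding nn_integral_energy(1)[OF \<eta>(1)] e1_def[symmetric] e0(2) .
      then have "ennreal (real (N ^ ?n) * e1) \<le> ennreal (real ((N + 2 * k) ^ ?n) * e0
          + K * (real N ^ ?n - (real N - 6) ^ ?n) * vol)"
        using e0(1) e1(1) r
        by (simp add: ennreal_of_nat_eq_real_of_nat ennreal_mult'[symmetric] ennreal_plus[symmetric] del: ennreal_plus of_nat_power)
      then have "real N ^ ?n * e1 \<le> (real N + 2 * real k) ^ ?n * e0
          + K * (real N ^ ?n - (real N - 6) ^ ?n) * vol"
        using e0(1) r by (subst (asm) ennreal_le_iff) auto
      moreover have "real N ^ ?n * m \<le> real N ^ ?n * e1"
        using e1(2) by (intro mult_left_mono) auto
      ultimately have "real N ^ ?n * m \<le> (real N + 2 * real k) ^ ?n * e0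
          + K * (real N ^ ?n - (real N - 6) ^ ?n) * vol"
        by linarith
      moreover have "real N ^ ?n > 0"
        using N by simp
      ultimately show ?thesis
        by (simp add: field_simps)
    qed
    \<comment> \<open>Both ratios tend to 1, so the competitor bound tends to the energy of phi
      alone.\<close>
    have "(\<lambda>N. (real N + 2 * real k) ^ ?n / real N ^ ?n * e0
        + K * (1 - (real N + (- 6)) ^ ?n / real N ^ ?n) * vol) \<longlonglongrightarrow> 1 * e0 + K * (1 - 1) * vol"
      by (intro tendsto_intros tendsto_shifted_ratio)
    then have "m \<le> 1 * e0 + K * (1 - 1) * vol"
      by (rule LIMSEQ_le_const) (use bound in blast)
    then show ?thesis
      using en by (simp add: m_def e0_def)
  qed
  then have "vol * (pull H E \<bullet> C0 (pull H E)) \<le> vol * (E \<bullet> C0 E)"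
    by (rule field_le_epsilon)
  then show ?thesis
    using cell_measure_pos by simp
qed

lemma macroscopic_polarization:
  assumes mac: "macroscopic_elasticity_tensor p b C C0" and EF: "E \<in> Sym" "F \<in> Sym"
  shows "(E + F) \<bullet> C0 (E + F) = E \<bullet> C0 E + F \<bullet> C0 F + 2 * (F \<bullet> C0 E)"
proof -
  have "E + F \<in> Sym"
    using EF by (simp add: Sym_def transpose_def vec_eq_iff)
  then have "(E + F) \<bullet> C0 (E + F) = (E + F) \<bullet> C0 E + (E + F) \<bullet> C0 F"
    using macroscopic_symmetric[OF mac EF(1), of "E + F"] macroscopic_symmetric[OF mac EF(2), of "E + F"]
    by (simp add: inner_add_left)
  then show ?thesis
    using macroscopic_symmetric[OF mac EF] by (simp add: inner_add_left)
qed

lemma macroscopic_symmetry: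
  assumes mac: "macroscopic_elasticity_tensor p b C C0" and E: "E \<in> Sym"
    and H: "\<bar>det H\<bar> = 1" and inv: "\<And>y A. q (c + H *v y) A = q y (pull H A)"
  shows "C0 E = H ** C0 (pull H E) ** transpose H"
proof -
  obtain G where G: "H ** G = mat 1" "G ** H = mat 1" "\<bar>det G\<bar> = 1"
    using abs_det_one_inverse[OF H] .
  \<comment> \<open>The inverse affine map has matrix G, and \<open>pull G\<close> inverts
    \<open>pull H\<close>; the invariance of q is thus of the same form for the inverse.\<close>
  have invG: "q (- (G *v c) + G *v z) A = q z (pull G A)" for z A
  proof -
    have "c + H *v (- (G *v c) + G *v z) = z"
      by (simp add: matrix_vector_right_distrib matrix_vector_mult_diff_distrib matrix_vector_mul_assoc G)
    then have "q z (pull G A) = q (- (G *v c) + G *v z) (pull H (pull G A))"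
      using inv by metis
    then show ?thesis
      by (simp add: pull_pull G pull_one)
  qed
  have quad: "pull H F \<bullet> C0 (pull H F) = F \<bullet> C0 F" if F: "F \<in> Sym" for F
  proof (rule antisym)
    show "pull H F \<bullet> C0 (pull H F) \<le> F \<bullet> C0 F"
      by (rule macroscopic_energy_pull_le[OF mac F H inv])
    show "F \<bullet> C0 F \<le> pull H F \<bullet> C0 (pull H F)"
      using macroscopic_energy_pull_le[OF mac pull_Sym[OF F, of H] G(3) invG]
      by (simp add: pull_pull G pull_one)
  qed
  \<comment> \<open>Symmetry of C0 makes its bilinear form recoverable from the quadratic one,
    evaluated at E, F and E + F.\<close>
  have bil: "F \<bullet> C0 E = pull H F \<bullet> C0 (pull H E)" if F: "F \<in> Sym" for F
  proof -
    have "E + F \<in> Sym"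
      using E F by (simp add: Sym_def transpose_def vec_eq_iff)
    then show ?thesis
      using macroscopic_polarization[OF mac E F] quad[OF E] quad[OF F] quad[of "E + F"]
        macroscopic_polarization[OF mac pull_Sym[OF E] pull_Sym[OF F], of H H]
      by (simp add: pull_add)
  qed
  \<comment> \<open>To identify matrices the test matrix must be arbitrary. Both tensors pair only
    with symmetric parts, and taking symmetric parts commutes with \<open>pull H\<close>.\<close>
  have "A \<bullet> C0 E = A \<bullet> (H ** C0 (pull H E) ** transpose H)" for A
  proof -
    have "A \<bullet> C0 E = pull H (sym_part A) \<bullet> C0 (pull H E)"
      using inner_C0_sym_part[OF mac E] bil[OF sym_part_Sym] by simp
    also have "\<dots> = pull H A \<bullet> C0 (pull H E)"
      using inner_C0_sym_part[OF mac pull_Sym[OF E, of H], of "pull H A"] by (simp add: sym_part_pull)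
    finally show ?thesis
      by (simp add: inner_push)
  qed
  then show ?thesis
    using vector_eq_ldot by blast
qed

text \<open>Puts the symmetry into the form used by the energy argument: the base point is absorbed
  into the constant vector, and the minor symmetries extend the identity from symmetric to arbitrary
  matrices.\<close>

lemma q_symmetry:
  assumes h: "\<And>z. h z = z0 + a + H *v (z - z0)" and H: "\<bar>det H\<bar> = 1" and sym: "symmetry_of C h H"
  shows "q (z0 + a - H *v z0 + H *v y) A = q y (pull H A)"
proof -
  have eq: "h y = z0 + a - H *v z0 + H *v y" for y
    by (simp add: h matrix_vector_mult_diff_distrib)
  obtain G where G: "G ** H = mat 1"
    using abs_det_one_inverse[OF H] .
  \<comment> \<open>\<open>symmetry_of\<close> is phrased with \<open>inv h\<close>; injectivity
    makes \<open>inv h (h y)\<close> equal to y.\<close>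
  have "inj h"
  proof (rule injI)
    fix x y assume "h x = h y"
    then have "G *v (H *v x) = G *v (H *v y)"
      by (simp add: eq)
    then show "x = y"
      by (simp add: matrix_vector_mul_assoc G)
  qed
  then have "blinfun_apply (C (h y)) D = H ** blinfun_apply (C y) (pull H D) ** transpose H"
    if "D \<in> Sym" for D
    using sym that unfolding symmetry_of_def pull_def by (metis inv_f_f)
  then have "q (h y) D = q y (pull H D)" if "D \<in> Sym" for D
    using that inner_push[of D H] by (simp add: q_def inner_commute)
  moreover have "q z B = q z (sym_part B)" for z B
    using C_minor(1)[of B z B] C_minor(2)[of B z "sym_part B"] by (simp add: q_def inner_commute)
  ultimately show ?thesis
    using sym_part_Sym sym_part_pull eq by metis
qed

end

theorem theorem3p2:
  fixes p z0 a :: "real ^ 'n"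
    and b :: "'n \<Rightarrow> real ^ 'n"
    and C :: "real ^ 'n \<Rightarrow> 'n elasticity_tensor"
    and C0 :: "'n lin \<Rightarrow> 'n lin"
    and h :: "real ^ 'n \<Rightarrow> real ^ 'n"
    and H :: "'n lin"
  assumes "periodic_elastic_structure p b C"
    and "macroscopic_elasticity_tensor p b C C0"
    and "\<And>z. h z = z0 + a + H *v (z - z0)"
    and "\<bar>det H\<bar> = 1"
    and "symmetry_of C h H"
  shows "\<forall>E\<in>Sym. C0 E = H ** C0 (transpose H ** E ** H) ** transpose H"
proof -
  interpret elastic_structure p b C
    by unfold_locales (fact assms(1))
  show ?thesis
    using macroscopic_symmetry[OF assms(2) _ assms(4) q_symmetry[OF assms(3-5)]]
    unfolding pull_def by blast
qed

end
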